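(* Let $\lambda>0$, $1<p<\infty$, $\Lambda\in(0,1)$, and let $\mathcal S$ be a $\Lambda$-sparse family of dyadic cubes in $(\mathbb R_+,|\cdot|,\mu)$. Then for every $w\in\widetilde A_{p,\lambda-\frac12}$, $$\|\mathcal A_{\mathcal S}\|_{L^p(\mathbb R_+,w\,dx)\to L^p(\mathbb R_+,w\,dx)}\le C\,[w]_{\widetilde A_{p,\lambda-\frac12}}^{\max\{1,\frac1{p-1}\}},$$ where $C$ depends only on $p,\lambda,\Lambda$ (and the dyadic system), not on $w$ or $\mathcal S$.
   Context: Fix $\lambda>0$. On $\mathbb R_+=(0,\infty)$ let $d\mu(x)=x^{2\lambda}dx$; intervals are $B=(a,b)\subset\mathbb R_+$; $p'=p/(p-1)$; for a weight $w$, $w(E)=\int_E w\,dx$ and $L^p(\mathbb R_+,w\,dx)$ has norm $(\int_0^\infty|f|^pw\,dx)^{1/p}$. For $1<p<\infty$, $w\ge0$ measurable belongs to $\widetilde A_{p,\lambda-\frac12}$ if $[w]_{\widetilde A_{p,\lambda-\frac12}}:=\sup_{B}\big(\frac1{\mu(B)}\int_B w(t)dt\big)\big(\frac1{\mu(B)}\int_B t^{2\lambda p'}w(t)^{-\frac1{p-1}}dt\big)^{p-1}<\infty$ (supremum over intervals). $\mathcal D$ is a fixed system of dyadic cubes on the space of homogeneous type $(\mathbb R_+,|\cdot|,\mu)$ (Christ/Hytönen–Kairema type: nested partitions into "cubes" $Q^k_\alpha$ with $B(x^k_\alpha,a_1\delta^k)\subset Q^k_\alpha\subset B(x^k_\alpha,A_1\delta^k)$).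 A collection $\mathcal S\subset\mathcal D$ is $\Lambda$-sparse if for each $Q\in\mathcal S$ there is measurable $E_Q\subset Q$ with $\mu(E_Q)\ge\Lambda\mu(Q)$ and the sets $\{E_Q\}_{Q\in\mathcal S}$ have finite (bounded) overlap. The sparse operator is $\mathcal A_{\mathcal S}f(x)=\sum_{Q\in\mathcal S}\frac1{\mu(Q)}\int_Q f\,d\mu\cdot\chi_Q(x)$.
   Formalization: The overlap of the sets E_Q is required to be at most a fixed number N, and the constant C may depend on N as well as on p, λ, Λ and the dyadic system; with overlap bounds varying with the family no uniform C exists. *)

theory Defs
  imports "HOL-Analysis.Analysis"
begin

definition mu_lam :: "real \<Rightarrow> real measure" where
  "mu_lam lam = density lborel (\<lambda>x. ennreal (indicator {0<..} x * x powr (2 * lam)))"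

definition rball :: "real \<Rightarrow> real \<Rightarrow> real set" where
  "rball x r = {y. 0 < y \<and> \<bar>x - y\<bar> < r}"

text \<open>A system of dyadic cubes (Christ / Hytonen-Kairema type) on (R_+,|.|,mu):
  for each generation k :: int a countable partition D k of R_+ into Borel sets,
  nested across generations, each cube Q in D k squeezed between
  B(x, a1 delta^k) and B(x, A1 delta^k) for some centre x.\<close>
definition dyadic_system :: "real \<Rightarrow> real \<Rightarrow> real \<Rightarrow> (int \<Rightarrow> real set set) \<Rightarrow> bool" where
  "dyadic_system \<delta> a1 A1 D \<longleftrightarrow>
     0 < \<delta> \<and> \<delta> < 1 \<and> 0 < a1 \<and> a1 \<le> A1 \<and>
     (\<forall>k. countable (D k)) \<and>
     (\<forall>k. \<Union>(D k) = {0<..}) \<and>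
     (\<forall>k. \<forall>Q\<in>D k. \<forall>P\<in>D k. Q \<noteq> P \<longrightarrow> Q \<inter> P = {}) \<and>
     (\<forall>k. \<forall>Q\<in>D k. Q \<in> sets lborel) \<and>
     (\<forall>k l. k \<le> l \<longrightarrow> (\<forall>Q\<in>D k. \<forall>P\<in>D l. P \<subseteq> Q \<or> P \<inter> Q = {})) \<and>
     (\<forall>k. \<forall>Q\<in>D k. \<exists>x>0. rball x (a1 * \<delta> powr k) \<subseteq> Q \<and> Q \<subseteq> rball x (A1 * \<delta> powr k))"

definition dyadic_cubes :: "(int \<Rightarrow> real set set) \<Rightarrow> real set set" where
  "dyadic_cubes D = (\<Union>k. D k)"

definition sparse :: "real \<Rightarrow> real \<Rightarrow> nat \<Rightarrow> real set set \<Rightarrow> bool" where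
  "sparse lam \<Lambda> N S \<longleftrightarrow>
     (\<exists>E. (\<forall>Q\<in>S. E Q \<subseteq> Q \<and> E Q \<in> sets lborel \<and>
              measure (mu_lam lam) (E Q) \<ge> \<Lambda> * measure (mu_lam lam) Q) \<and>
          (\<forall>x. finite {Q\<in>S. x \<in> E Q} \<and> card {Q\<in>S. x \<in> E Q} \<le> N))"

definition avg :: "real \<Rightarrow> real set \<Rightarrow> (real \<Rightarrow> real) \<Rightarrow> real" where
  "avg lam Q f = (set_lebesgue_integral (mu_lam lam) Q f) / measure (mu_lam lam) Q"

definition sparse_op :: "real \<Rightarrow> real set set \<Rightarrow> (real \<Rightarrow> real) \<Rightarrow> real \<Rightarrow> real" where
  "sparse_op lam S f x = infsum (\<lambda>Q. avg lam Q f * indicator Q x) S"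

definition Ap_expr :: "real \<Rightarrow> real \<Rightarrow> (real \<Rightarrow> real) \<Rightarrow> real \<Rightarrow> real \<Rightarrow> real" where
  "Ap_expr lam p w a b =
     (let m = measure (mu_lam lam) {a<..<b};
          p' = p / (p - 1) in
      ((LBINT t:{a<..<b}. w t) / m) *
      ((LBINT t:{a<..<b}. t powr (2 * lam * p') * w t powr (- 1 / (p - 1))) / m) powr (p - 1))"

text \<open>Membership in A~_{p,lambda-1/2}: w measurable, nonnegative on R_+, a.e. positive on R_+
  (otherwise w^(-1/(p-1)) is infinite on a set of positive measure), both integrals finite
  on every interval (a,b) \<subseteq> R_+, and the supremum finite.\<close>
definition Ap_weight :: "real \<Rightarrow> real \<Rightarrow> (real \<Rightarrow> real) \<Rightarrow> bool" where
  "Ap_weight lam p w \<longleftrightarrow>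
     w \<in> borel_measurable lborel \<and> (\<forall>x>0. 0 \<le> w x) \<and>
     (AE t in lborel. 0 < t \<longrightarrow> 0 < w t) \<and>
     (\<forall>a b. 0 \<le> a \<and> a < b \<longrightarrow>
        set_integrable lborel {a<..<b} w \<and>
        set_integrable lborel {a<..<b} (\<lambda>t. t powr (2 * lam * (p / (p - 1))) * w t powr (- 1 / (p - 1)))) \<and>
     bdd_above {Ap_expr lam p w a b | a b. 0 \<le> a \<and> a < b}"

definition Ap_const :: "real \<Rightarrow> real \<Rightarrow> (real \<Rightarrow> real) \<Rightarrow> real" where
  "Ap_const lam p w = (SUP (a, b) \<in> {(a, b). 0 \<le> a \<and> a < b}. Ap_expr lam p w a b)"

definition Lp_w_pow :: "real \<Rightarrow> (real \<Rightarrow> real) \<Rightarrow> (real \<Rightarrow> real) \<Rightarrow> ennreal" where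
  "Lp_w_pow p w f = (\<integral>\<^sup>+ x. indicator {0<..} x * ennreal (\<bar>f x\<bar> powr p * w x) \<partial>lborel)"

end

theory Submission
  imports Defs
begin

text \<open>
  With \<open>\<sigma>(t) = t powr (2\<lambda>p') * w(t) powr (-1/(p-1))\<close> the density of \<open>\<mu>\<close> is \<open>w powr (1/p) * \<sigma> powr (1/p')\<close>, so
  Hoelder bounds \<open>\<mu>(E)\<close> by \<open>w(E) powr (1/p) * \<sigma>(E) powr (1/p')\<close>. Writing \<open>f d\<mu> = h \<sigma> dx\<close>, the norm of \<open>f\<close>
  in \<open>L^p(w)\<close> is that of \<open>h\<close> in \<open>L^p(\<sigma>)\<close>, and the sparse form tested against \<open>g\<close> is the sum over \<open>Q\<close> of
  the \<open>\<sigma>\<close>-average of \<open>h\<close>, times the \<open>w\<close>-average of \<open>g\<close>, times \<open>w(Q) \<sigma>(Q) / \<mu>(Q)\<close>. For \<open>p \<ge> 2\<close> the \<open>A_p\<close>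
  condition and sparseness bound the last factor by a multiple of
  \<open>[w] * w(E_Q) powr (1/p') * \<sigma>(E_Q) powr (1/p)\<close>; Hoelder for sums and the dyadic maximal inequalities,
  whose constants do not depend on the measure, then give the linear bound. The case \<open>p < 2\<close> is
  the same statement with \<open>(p, w)\<close> and \<open>(p', \<sigma>)\<close> exchanged. An infinite family
  is a monotone limit of finite ones.
\<close>

section \<open>Hoelder inequalities\<close>

lemma conjugate_exponent_facts:
  fixes p q :: real
  assumes "1 < p" "1 < q" "1/p + 1/q = 1"
  shows "(p - 1) * q = p" "p * (q - 1) = q" "1/q = 1 - 1/p"
proof -
  have "q + p = p * q" using assms by (simp add: field_simps)
  then show "(p - 1) * q = p" "p * (q - 1) = q"
    by (simp_all add: algebra_simps)
  show "1/q = 1 - 1/p" using assms by simp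
qed

text \<open>Young's inequality for \<open>f / a\<close> and \<open>g / b\<close>, where
  \<open>a\<close> and \<open>b\<close> are the roots of the two bounds, integrates to the claim.
  Taking upper bounds \<open>A\<close>, \<open>B\<close> instead of the norms themselves lets later
  steps insert estimates directly.\<close>

lemma nn_integral_Holder:
  fixes f g :: "'a \<Rightarrow> real"
  assumes p: "1 < p" "1 < q" "1/p + 1/q = 1"
    and [measurable]: "f \<in> borel_measurable M" "g \<in> borel_measurable M"
    and f0: "\<And>x. 0 \<le> f x" and g0: "\<And>x. 0 \<le> g x" and A: "0 \<le> A" and B: "0 \<le> B"
    and fA: "(\<integral>\<^sup>+x. ennreal (f x powr p) \<partial>M) \<le> ennreal A"
    and gB: "(\<integral>\<^sup>+x. ennreal (g x powr q) \<partial>M) \<le> ennreal B"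
  shows "(\<integral>\<^sup>+x. ennreal (f x * g x) \<partial>M) \<le> ennreal (A powr (1/p) * B powr (1/q))"
\<comment> \<open>Normalisation by \<open>a\<close> and \<open>b\<close> fails when one bound
  vanishes; then one factor is zero almost everywhere.\<close>
proof (cases "A = 0 \<or> B = 0")
  case True
  then have "AE x in M. f x * g x = 0"
  proof
    assume "A = 0"
    then have "(\<integral>\<^sup>+x. ennreal (f x powr p) \<partial>M) = 0" using fA by simp
    then have "AE x in M. ennreal (f x powr p) = 0" by (subst (asm) nn_integral_0_iff_AE) auto
    then show ?thesis by eventually_elim (auto simp: ennreal_eq_0_iff)
  next
    assume "B = 0"
    then have "(\<integral>\<^sup>+x. ennreal (g x powr q) \<partial>M) = 0" using gB by simp
    then have "AE x in M. ennreal (g x powr q) = 0" by (subst (asm) nn_integral_0_iff_AE) auto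
    then show ?thesis by eventually_elim (auto simp: ennreal_eq_0_iff)
  qed
  then have "(\<integral>\<^sup>+x. ennreal (f x * g x) \<partial>M) = (\<integral>\<^sup>+x. 0 \<partial>M)"
    by (intro nn_integral_cong_AE) auto
  then show ?thesis by simp
next
  case False
  then have A': "A > 0" and B': "B > 0" using A B by auto
  define a where "a = A powr (1/p)"
  define b where "b = B powr (1/q)"
  have ab: "a > 0" "b > 0" using A' B' by (auto simp: a_def b_def)
  have ap: "a powr p = A" "b powr q = B" using p A' B' by (auto simp: a_def b_def powr_powr)
  have pt: "f x * g x \<le> (a*b/(p*A)) * f x powr p + (a*b/(q*B)) * g x powr q" for x
  proof -
    have "(f x / a) * (g x / b) \<le> (f x / a) powr p / p + (g x / b) powr q / q"
      by (rule Youngs_inequality) (use p f0 g0 ab in auto)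
    also have "\<dots> = f x powr p / A / p + g x powr q / B / q"
      using f0 g0 ab ap by (simp add: powr_divide)
    finally have "(a*b) * ((f x / a) * (g x / b)) \<le> (a*b) * (f x powr p / A / p + g x powr q / B / q)"
      using ab by (intro mult_left_mono) auto
    moreover have "(a*b) * ((f x / a) * (g x / b)) = f x * g x" using ab by simp
    moreover have "(a*b) * (f x powr p / A / p + g x powr q / B / q)
        = (a*b/(p*A)) * f x powr p + (a*b/(q*B)) * g x powr q" by (simp add: algebra_simps)
    ultimately show ?thesis by simp
  qed
  have "(\<integral>\<^sup>+x. ennreal (f x * g x) \<partial>M)
      \<le> (\<integral>\<^sup>+x. ennreal (a*b/(p*A)) * ennreal (f x powr p) + ennreal (a*b/(q*B)) * ennreal (g x powr q) \<partial>M)"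
    using ab A' B' p
    by (intro nn_integral_mono) (auto simp: pt[simplified] simp flip: ennreal_mult ennreal_plus intro!: ennreal_leI)
  also have "\<dots> = ennreal (a*b/(p*A)) * (\<integral>\<^sup>+x. ennreal (f x powr p) \<partial>M)
      + ennreal (a*b/(q*B)) * (\<integral>\<^sup>+x. ennreal (g x powr q) \<partial>M)"
    by (simp add: nn_integral_add nn_integral_cmult)
  also have "\<dots> \<le> ennreal (a*b/(p*A)) * ennreal A + ennreal (a*b/(q*B)) * ennreal B"
    by (intro add_mono mult_left_mono fA gB) auto
  also have "\<dots> = ennreal (a*b/(p*A) * A + a*b/(q*B) * B)"
    using ab A' B' p(1,2) by (simp flip: ennreal_mult ennreal_plus del: times_divide_eq_left)
  also have "a*b/(p*A) * A + a*b/(q*B) * B = a * b * (1/p + 1/q)"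
    using A' B' by (simp add: field_simps)
  finally show ?thesis using p by (simp add: a_def b_def)
qed

lemma sum_Holder:
  fixes f g :: "'a \<Rightarrow> real"
  assumes p: "1 < p" "1 < q" "1/p + 1/q = 1" and fin: "finite S"
    and f0: "\<And>x. 0 \<le> f x" and g0: "\<And>x. 0 \<le> g x"
  shows "(\<Sum>x\<in>S. f x * g x) \<le> (\<Sum>x\<in>S. f x powr p) powr (1/p) * (\<Sum>x\<in>S. g x powr q) powr (1/q)"
proof -
  have "(\<integral>\<^sup>+x. ennreal (f x * g x) \<partial>count_space S)
      \<le> ennreal ((\<Sum>x\<in>S. f x powr p) powr (1/p) * (\<Sum>x\<in>S. g x powr q) powr (1/q))"
    by (rule nn_integral_Holder)
       (use p fin f0 g0 in \<open>auto simp: nn_integral_count_space_finite sum_ennreal intro!: sum_nonneg\<close>)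
  then show ?thesis
    using fin f0 g0 by (simp add: nn_integral_count_space_finite sum_ennreal)
qed

section \<open>Power inequalities and a discrete layer-cake formula\<close>

lemma le_powr_of_le_self_powr:
  fixes X c p q :: real
  assumes "1 < p" "1 < q" "1/p + 1/q = 1" "0 \<le> X" "X \<le> c * X powr (1/q)"
  shows "X \<le> c powr p"
proof (cases "X = 0")
  case False
  then have X: "X > 0" using assms by simp
  \<comment> \<open>Absorption: the factor \<open>X powr (1/q)\<close> cancels from both sides. That
    \<open>X\<close> is a real number encodes the finiteness this requires.\<close>
  have "X powr (1/p) * X powr (1/q) = X" using assms X by (simp flip: powr_add)
  then have "X powr (1/p) * X powr (1/q) \<le> c * X powr (1/q)" using assms by simp
  then have "X powr (1/p) \<le> c" using X by simp
  then have "(X powr (1/p)) powr p \<le> c powr p" using assms by (intro powr_mono2) auto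
  then show ?thesis using assms X by (simp add: powr_powr)
qed simp

text \<open>Finite-difference form of d(t^p) = q t d(t^(p-1)), which holds because p = q (p-1). It
  follows from Young's inequality for the mixed term b a^(p-1).\<close>

lemma powr_diff_le:
  fixes a b p q :: real
  assumes p: "1 < p" "1 < q" "1/p + 1/q = 1" and "0 \<le> a" "0 \<le> b"
  shows "b powr p - a powr p \<le> q * b * (b powr (p - 1) - a powr (p - 1))"
proof -
  have "b * a powr (p-1) \<le> b powr p / p + (a powr (p-1)) powr q / q"
    by (rule Youngs_inequality) (use assms in auto)
  also have "(a powr (p-1)) powr q = a powr p"
    using conjugate_exponent_facts[OF p] by (simp add: powr_powr)
  finally have "q * (b * a powr (p-1)) \<le> q * (b powr p / p + a powr p / q)"
    using p by (intro mult_left_mono) auto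
  also have "\<dots> = (q/p) * b powr p + a powr p" using p(1,2) by (simp add: distrib_left)
  also have "q/p = q - 1" using conjugate_exponent_facts[OF p] p by (simp add: field_simps)
  finally have 1: "q * (b * a powr (p-1)) \<le> (q - 1) * b powr p + a powr p" .
  have "b * b powr (p-1) = b powr p"
    using powr_mult_base[of b "p-1"] assms by simp
  then have "q * b * (b powr (p - 1) - a powr (p - 1)) = q * b powr p - q * (b * a powr (p-1))"
    by (simp add: right_diff_distrib)
  then show ?thesis using 1 by (simp add: left_diff_distrib)
qed

text \<open>A layer-cake formula for functions with finitely many values.\<close>

lemma sum_over_finite_levels:
  fixes \<phi> :: "real \<Rightarrow> real"
  assumes "finite V" "V \<subseteq> {0<..}" "\<phi> 0 = 0" "m \<in> insert 0 V"
  shows "\<phi> m = (\<Sum>t\<in>V. (\<phi> t - \<phi> (Max (insert 0 {s\<in>V. s < t}))) * of_bool (t \<le> m))"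
  using assms
proof (induction arbitrary: m rule: finite_linorder_max_induct)
  case empty
  then show ?case by simp
next
  case (insert b A)
  have eq: "{s \<in> insert b A. s < t} = {s\<in>A. s < t}" if "t \<in> A" for t
    using insert(2) that by force
  have eqb: "{s \<in> insert b A. s < b} = A"
    using insert(2) by force
  have bA: "b \<notin> A" using insert(2) by blast
  have 1: "(\<Sum>t\<in>insert b A. (\<phi> t - \<phi> (Max (insert 0 {s\<in>insert b A. s < t}))) * of_bool (t \<le> m))
     = (\<phi> b - \<phi> (Max (insert 0 A))) * of_bool (b \<le> m) +
       (\<Sum>t\<in>A. (\<phi> t - \<phi> (Max (insert 0 {s\<in>A. s < t}))) * of_bool (t \<le> m))"
    unfolding sum.insert[OF insert(1) bA] eqb using eq by (intro arg_cong2[where f="(+)"] sum.cong refl) auto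
  show ?case
  proof (cases "m = b")
    case False
    then have m: "m \<in> insert 0 A" using insert.prems by auto
    then have "\<not> b \<le> m" using insert(2) insert.prems(1) by force
    then show ?thesis using insert.IH[OF _ _ m] insert.prems unfolding 1 by simp
  next
    \<comment> \<open>At the top level \<open>b\<close> the new increment starts from the previous
      maximum, so it telescopes with the induction hypothesis taken at that maximum.\<close>
    case True
    let ?m = "Max (insert 0 A)"
    have mm: "?m \<in> insert 0 A" using insert(1) by (intro Max_in) auto
    have "\<phi> ?m = (\<Sum>t\<in>A. (\<phi> t - \<phi> (Max (insert 0 {s\<in>A. s < t}))) * of_bool (t \<le> ?m))"
      using insert.IH[OF _ _ mm] insert.prems by simp
    also have "\<dots> = (\<Sum>t\<in>A. (\<phi> t - \<phi> (Max (insert 0 {s\<in>A. s < t}))) * of_bool (t \<le> m))"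
      using insert(1,2) True by (intro sum.cong refl) (auto intro!: less_imp_le)
    finally show ?thesis unfolding 1 using True by simp
  qed
qed

section \<open>Maximal functions of laminar families\<close>

text \<open>Isolates the nesting of dyadic cubes, so that the maximal and embedding estimates can be
  proved on an arbitrary measure space, without generations or geometry.\<close>

definition laminar :: "'a set set \<Rightarrow> bool" where
  "laminar S \<longleftrightarrow> (\<forall>P\<in>S. \<forall>Q\<in>S. P \<subseteq> Q \<or> Q \<subseteq> P \<or> P \<inter> Q = {})"

lemma laminar_subset: "laminar S \<Longrightarrow> T \<subseteq> S \<Longrightarrow> laminar T"
  unfolding laminar_def by blast

text \<open>The inclusion-maximal members work: finiteness puts every member inside a maximal one,
  and laminarity makes distinct maximal ones disjoint.\<close>

lemma laminar_disjoint_cover: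
  assumes "finite S" "laminar S"
  obtains T where "T \<subseteq> S" "disjoint T" "\<Union>T = \<Union>S"
proof -
  define T where "T = {Q\<in>S. \<forall>P\<in>S. Q \<subseteq> P \<longrightarrow> Q = P}"
  have TS: "T \<subseteq> S" by (auto simp: T_def)
  have "P \<inter> Q = {}" if "P \<in> T" "Q \<in> T" "P \<noteq> Q" for P Q
  proof -
    have "P \<subseteq> Q \<or> Q \<subseteq> P \<or> P \<inter> Q = {}"
      using assms(2) that TS unfolding laminar_def by (meson subsetD)
    then show ?thesis using that by (auto simp: T_def)
  qed
  then have "disjoint T" unfolding disjoint_def by auto
  moreover have "\<Union>T = \<Union>S"
  proof
    show "\<Union>S \<subseteq> \<Union>T"
    proof
      fix x assume "x \<in> \<Union>S"
      then obtain Q where Q: "Q \<in> S" "x \<in> Q" by blast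
      obtain m where "m \<in> S" "Q \<subseteq> m" "\<forall>b\<in>S. m \<subseteq> b \<longrightarrow> m = b"
        using finite_has_maximal2[OF assms(1) Q(1)] by blast
      then show "x \<in> \<Union>T" using Q unfolding T_def by blast
    qed
  qed (auto simp: T_def)
  ultimately show thesis using that[OF TS] by simp
qed

lemma nn_set_integral_Holder:
  fixes h :: "'a \<Rightarrow> real"
  assumes p: "1 < p" "1 < q" "1/p + 1/q = 1"
    and [measurable]: "h \<in> borel_measurable M" and h0: "\<And>x. 0 \<le> h x" and A: "0 \<le> A"
    and hA: "(\<integral>\<^sup>+x. ennreal (h x powr p) \<partial>M) \<le> ennreal A"
    and Q[measurable]: "Q \<in> sets M" and finQ: "emeasure M Q < \<infinity>"
  shows "(\<integral>\<^sup>+x\<in>Q. ennreal (h x) \<partial>M) \<le> ennreal (A powr (1/p) * measure M Q powr (1/q))"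
proof -
  have "(\<integral>\<^sup>+x. ennreal (h x * indicator Q x) \<partial>M) \<le> ennreal (A powr (1/p) * measure M Q powr (1/q))"
  proof (rule nn_integral_Holder[OF p _ _ _ _ A _ hA])
    have "(\<integral>\<^sup>+x. ennreal (indicator Q x powr q) \<partial>M) = (\<integral>\<^sup>+x. indicator Q x \<partial>M)"
      by (intro nn_integral_cong) (auto split: split_indicator)
    also have "\<dots> = ennreal (measure M Q)"
      using finQ by (simp add: emeasure_eq_ennreal_measure)
    finally show "(\<integral>\<^sup>+x. ennreal (indicator Q x powr q) \<partial>M) \<le> ennreal (measure M Q)" by simp
  qed (use h0 in auto)
  also have "(\<integral>\<^sup>+x. ennreal (h x * indicator Q x) \<partial>M) = (\<integral>\<^sup>+x\<in>Q. ennreal (h x) \<partial>M)"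
    by (intro nn_integral_cong) (auto split: split_indicator)
  finally show ?thesis .
qed

text \<open>Doob's maximal inequality. With \<open>g\<close> the largest average at a point,
  disjoint maximal sets give the weak-type bound on each level set. Summation over levels turns it
  into a bound of the integral of g^p by q times that of h g^(p-1); Hoelder and absorption finish.
  No doubling enters, so the constant is the same for every measure.\<close>

lemma laminar_maximal_function:
  fixes h :: "'a \<Rightarrow> real"
  assumes p: "1 < p" "1 < q" "1/p + 1/q = 1"
    and S: "finite S" "laminar S" "S \<subseteq> sets M" "\<And>Q. Q \<in> S \<Longrightarrow> emeasure M Q < \<infinity>"
    and [measurable]: "h \<in> borel_measurable M" and h0: "\<And>x. 0 \<le> h x" and A: "0 \<le> A"
    and hA: "(\<integral>\<^sup>+x. ennreal (h x powr p) \<partial>M) \<le> ennreal A"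
  obtains g :: "'a \<Rightarrow> real" where "g \<in> borel_measurable M" "\<And>x. 0 \<le> g x"
    "\<And>Q x. Q \<in> S \<Longrightarrow> x \<in> Q \<Longrightarrow> enn2real (\<integral>\<^sup>+x\<in>Q. ennreal (h x) \<partial>M) / measure M Q \<le> g x"
    "(\<integral>\<^sup>+x. ennreal (g x powr p) \<partial>M) \<le> ennreal (q powr p * A)"
proof -
  define I where "I Q = (\<integral>\<^sup>+x\<in>Q. ennreal (h x) \<partial>M)" for Q
  define c where "c Q = enn2real (I Q) / measure M Q" for Q
  define g where "g x = Max ((\<lambda>Q. c Q * indicator Q x) ` S \<union> {0})" for x
  define V where "V = {t \<in> c ` S. 0 < t}"
  define L where "L t = \<Union>{Q\<in>S. t \<le> c Q}" for t
  \<comment> \<open>\<open>g\<close> takes values in the finite set \<open>V\<close> together with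
    0, and \<open>pr t\<close> is the value just below \<open>t\<close>.\<close>
  define pr where "pr t = Max (insert 0 {s\<in>V. s < t})" for t
  have S_sets[measurable]: "Q \<in> sets M" if "Q \<in> S" for Q using S(3) that by auto
  have c0: "0 \<le> c Q" for Q by (simp add: c_def)
  have I_fin: "I Q < \<infinity>" if "Q \<in> S" for Q
  proof -
    have "I Q \<le> ennreal (A powr (1/p) * measure M Q powr (1/q))"
      unfolding I_def by (rule nn_set_integral_Holder[OF p _ h0 A hA]) (use S that in auto)
    then show ?thesis by (simp add: le_less_trans)
  qed
  have g0: "0 \<le> g x" for x unfolding g_def using S(1) by (intro Max_ge) auto
  have g_ge: "c Q \<le> g x" if "Q \<in> S" "x \<in> Q" for Q x
    unfolding g_def using S(1) that by (intro Max_ge) (auto intro!: rev_image_eqI)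
  have g_in: "g x \<in> (\<lambda>Q. c Q * indicator Q x) ` S \<union> {0}" for x
    unfolding g_def using S(1) by (intro Max_in) auto
  have g_V: "g x \<in> insert 0 V" for x
    using g_in[of x] c0 by (auto simp: V_def indicator_def less_le split: if_splits)
  have t_le_g: "t \<le> g x \<longleftrightarrow> x \<in> L t" if "0 < t" for t x
  proof
    assume "t \<le> g x"
    then show "x \<in> L t" using g_in[of x] that by (auto simp: L_def split: split_indicator_asm)
  next
    assume "x \<in> L t"
    then show "t \<le> g x" using g_ge by (fastforce simp: L_def)
  qed
  have g_meas[measurable]: "g \<in> borel_measurable M"
  proof -
    \<comment> \<open>Indexing the maximum by functions absorbs the extra value 0 as the zero
      function, giving one fixed finite index set.\<close>
    have "(\<lambda>x. Max ((\<lambda>F. F x) ` ((\<lambda>Q x. c Q * indicator Q x) ` S \<union> {\<lambda>x. 0}))) \<in> borel_measurable M"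
      using S(1) by (intro borel_measurable_Max) auto
    then show ?thesis unfolding g_def by (simp add: image_image image_Un)
  qed
  have fV: "finite V" and V0: "V \<subseteq> {0<..}" using S(1) by (auto simp: V_def)
  have L_sets[measurable]: "L t \<in> sets M" for t
    unfolding L_def using S(1,3) by (intro sets.finite_Union) auto
  have weak: "ennreal t * emeasure M (L t) \<le> (\<integral>\<^sup>+x\<in>L t. ennreal (h x) \<partial>M)" if t: "0 < t" for t
  proof -
    have "finite {Q\<in>S. t \<le> c Q}" "laminar {Q\<in>S. t \<le> c Q}"
      using S(1) by (auto intro: laminar_subset[OF S(2)])
    then obtain T where T: "T \<subseteq> {Q\<in>S. t \<le> c Q}" "disjoint T" "\<Union>T = \<Union>{Q\<in>S. t \<le> c Q}"
      by (rule laminar_disjoint_cover)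
    have fT: "finite T" "T \<subseteq> sets M" using T(1) S(1,3) by (auto intro: finite_subset)
    have LT: "L t = (\<Union>Q\<in>T. Q)" using T(3) by (simp add: L_def)
    have dj: "disjoint_family_on (\<lambda>Q. Q) T" using T(2) by (auto simp: disjoint_family_on_def disjoint_def)
    have 1: "emeasure M (L t) = (\<Sum>Q\<in>T. emeasure M Q)"
      unfolding LT using fT dj by (intro sum_emeasure[symmetric]) auto
    have "(\<integral>\<^sup>+x\<in>L t. ennreal (h x) \<partial>M) = emeasure (density M h) (L t)"
      by (simp add: emeasure_density)
    also have "\<dots> = (\<Sum>Q\<in>T. emeasure (density M h) Q)"
      unfolding LT using fT dj by (intro sum_emeasure[symmetric]) auto
    also have "\<dots> = (\<Sum>Q\<in>T. I Q)"
      unfolding I_def using fT by (intro sum.cong refl emeasure_density) auto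
    finally have 2: "(\<integral>\<^sup>+x\<in>L t. ennreal (h x) \<partial>M) = (\<Sum>Q\<in>T. I Q)" .
    have "ennreal t * emeasure M Q \<le> I Q" if "Q \<in> T" for Q
    proof -
      have Q: "Q \<in> S" "t \<le> c Q" using that T(1) by auto
      then have "0 < c Q" using t by simp
      \<comment> \<open>Division by zero yields 0, so a positive average forces positive
        measure.\<close>
      then have "0 < measure M Q" unfolding c_def by (simp add: zero_less_divide_iff measure_nonneg not_less)
      then have "t * measure M Q \<le> enn2real (I Q)" using Q(2) by (simp add: c_def field_simps)
      then have "ennreal (t * measure M Q) \<le> ennreal (enn2real (I Q))" by (rule ennreal_leI)
      then show ?thesis using S(4)[OF Q(1)] I_fin[OF Q(1)] t
        by (simp add: ennreal_mult emeasure_eq_ennreal_measure)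
    qed
    then show ?thesis unfolding 1 2 sum_distrib_left by (intro sum_mono) auto
  qed
  have pr: "0 \<le> pr t \<and> pr t < t" if "t \<in> V" for t
  proof -
    have "pr t \<in> insert 0 {s\<in>V. s < t}" unfolding pr_def using fV by (intro Max_in) auto
    moreover have "0 \<le> pr t" unfolding pr_def using fV by (intro Max_ge) auto
    ultimately show ?thesis using V0 that by auto
  qed
  define G where "G = (\<integral>\<^sup>+x. ennreal (g x powr p) \<partial>M)"
  \<comment> \<open>Used twice: with exponent p and \<open>k\<close> = 1 for the norm of
    \<open>g\<close>, then with exponent p - 1 and \<open>k\<close> = \<open>h\<close> to reassemble
    the sum after the weak-type bound.\<close>
  have levels: "(\<integral>\<^sup>+x. ennreal (g x powr r) * ennreal (k x) \<partial>M)
      = (\<Sum>t\<in>V. ennreal (t powr r - pr t powr r) * (\<integral>\<^sup>+x\<in>L t. ennreal (k x) \<partial>M))"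
    if r: "0 < r" and [measurable]: "k \<in> borel_measurable M" for r and k :: "'a \<Rightarrow> real"
  proof -
    have mono: "0 \<le> t powr r - pr t powr r" if "t \<in> V" for t
      using pr[OF that] r by (simp add: powr_mono2)
    have "ennreal (g x powr r) = (\<Sum>t\<in>V. ennreal (t powr r - pr t powr r) * indicator (L t) x)" for x
    proof -
      have "g x powr r = (\<Sum>t\<in>V. (t powr r - pr t powr r) * of_bool (t \<le> g x))"
        unfolding pr_def by (rule sum_over_finite_levels[OF fV V0 _ g_V]) (use r in auto)
      also have "\<dots> = (\<Sum>t\<in>V. (t powr r - pr t powr r) * indicator (L t) x)"
        using V0 t_le_g by (intro sum.cong refl) (auto simp: indicator_def)
      finally show ?thesis using mono
        by (simp add: sum_ennreal[symmetric] ennreal_mult' del: sum_ennreal)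
           (auto intro!: sum.cong split: split_indicator)
    qed
    then have "(\<integral>\<^sup>+x. ennreal (g x powr r) * ennreal (k x) \<partial>M)
      = (\<integral>\<^sup>+x. (\<Sum>t\<in>V. ennreal (t powr r - pr t powr r) * (ennreal (k x) * indicator (L t) x)) \<partial>M)"
      by (simp add: sum_distrib_left sum_distrib_right mult_ac)
    also have "\<dots> = (\<Sum>t\<in>V. ennreal (t powr r - pr t powr r) * (\<integral>\<^sup>+x\<in>L t. ennreal (k x) \<partial>M))"
      by (simp add: nn_integral_sum nn_integral_cmult)
    finally show ?thesis .
  qed
  have "G = (\<Sum>t\<in>V. ennreal (t powr p - pr t powr p) * emeasure M (L t))"
    using levels[of p "\<lambda>_. 1"] p by (simp add: G_def)
  also have "\<dots> \<le> (\<Sum>t\<in>V. ennreal q * (ennreal (t powr (p-1) - pr t powr (p-1)) * (\<integral>\<^sup>+x\<in>L t. ennreal (h x) \<partial>M)))"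
  proof (rule sum_mono)
    fix t assume t: "t \<in> V"
    then have t0: "0 < t" using V0 by auto
    have d0: "0 \<le> t powr (p-1) - pr t powr (p-1)" using pr[OF t] p by (simp add: powr_mono2)
    have "ennreal (t powr p - pr t powr p) * emeasure M (L t)
        \<le> ennreal (q * (t powr (p-1) - pr t powr (p-1)) * t) * emeasure M (L t)"
      using powr_diff_le[OF p, of "pr t" t] pr[OF t] t0
      by (intro mult_right_mono ennreal_leI) (auto simp: mult_ac)
    also have "\<dots> = ennreal q * (ennreal (t powr (p-1) - pr t powr (p-1)) * (ennreal t * emeasure M (L t)))"
      using p t0 d0 by (simp add: ennreal_mult mult_ac)
    also have "\<dots> \<le> ennreal q * (ennreal (t powr (p-1) - pr t powr (p-1)) * (\<integral>\<^sup>+x\<in>L t. ennreal (h x) \<partial>M))"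
      by (intro mult_left_mono weak t0) auto
    finally show "ennreal (t powr p - pr t powr p) * emeasure M (L t)
        \<le> ennreal q * (ennreal (t powr (p-1) - pr t powr (p-1)) * (\<integral>\<^sup>+x\<in>L t. ennreal (h x) \<partial>M))" .
  qed
  also have "\<dots> = ennreal q * (\<integral>\<^sup>+x. ennreal (g x powr (p-1)) * ennreal (h x) \<partial>M)"
    using levels[of "p-1" h] p by (simp add: sum_distrib_left)
  finally have G_le: "G \<le> ennreal q * (\<integral>\<^sup>+x. ennreal (h x * g x powr (p-1)) \<partial>M)"
    using h0 by (simp add: ennreal_mult mult_ac)
  \<comment> \<open>A crude bound of the maximum by the sum; it serves to show that \<open>G\<close>
    is finite, as the absorption requires.\<close>
  have "G \<le> (\<Sum>Q\<in>S. ennreal (c Q powr p) * emeasure M Q)"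
  proof -
    have "g x powr p \<le> (\<Sum>Q\<in>S. c Q powr p * indicator Q x)" for x
    proof (cases "g x = 0")
      case False
      then obtain Q where Q: "Q \<in> S" "x \<in> Q" "g x = c Q"
        using g_in[of x] by (auto simp: indicator_def split: if_splits)
      have "c Q powr p * indicator Q x \<le> (\<Sum>Q\<in>S. c Q powr p * indicator Q x)"
        by (rule member_le_sum) (use Q S in auto)
      then show ?thesis using Q by simp
    qed (auto intro: sum_nonneg)
    then have "G \<le> (\<integral>\<^sup>+x. ennreal (\<Sum>Q\<in>S. c Q powr p * indicator Q x) \<partial>M)"
      unfolding G_def by (intro nn_integral_mono ennreal_leI)
    also have "\<dots> = (\<integral>\<^sup>+x. (\<Sum>Q\<in>S. ennreal (c Q powr p) * indicator Q x) \<partial>M)"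
      by (intro nn_integral_cong)
         (simp add: sum_ennreal[symmetric] ennreal_mult' ennreal_indicator del: sum_ennreal)
    also have "\<dots> = (\<Sum>Q\<in>S. ennreal (c Q powr p) * emeasure M Q)"
      by (simp add: nn_integral_sum nn_integral_cmult)
    finally show ?thesis .
  qed
  also have "\<dots> < \<infinity>" using S by (simp add: ennreal_mult_less_top)
  finally have G_fin: "G < \<infinity>" .
  define X where "X = enn2real G"
  have GX: "G = ennreal X" using G_fin by (simp add: X_def)
  have X0: "0 \<le> X" by (simp add: X_def)
  have "(\<integral>\<^sup>+x. ennreal (h x * g x powr (p-1)) \<partial>M) \<le> ennreal (A powr (1/p) * X powr (1/q))"
    by (rule nn_integral_Holder[OF p _ _ h0 _ A X0 hA])
       (use conjugate_exponent_facts[OF p] GX in \<open>auto simp: powr_powr G_def\<close>)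
  then have "ennreal X \<le> ennreal q * ennreal (A powr (1/p) * X powr (1/q))"
    using G_le GX by (metis (no_types, lifting) mult_left_mono order_trans zero_le)
  then have "X \<le> q * A powr (1/p) * X powr (1/q)"
    using p by (simp add: ennreal_mult[symmetric] mult_ac)
  then have "X \<le> (q * A powr (1/p)) powr p"
    by (rule le_powr_of_le_self_powr[OF p X0])
  also have "\<dots> = q powr p * A" using p A by (simp add: powr_mult powr_powr)
  finally have "G \<le> ennreal (q powr p * A)" unfolding GX by (rule ennreal_leI)
  then show thesis
    using that[of g] g_meas g0 g_ge unfolding G_def c_def I_def by blast
qed

text \<open>On \<open>E Q\<close> the average over \<open>Q\<close> is at most the maximal function
  \<open>g\<close>, and at most \<open>N\<close> of the sets \<open>E Q\<close> meet at a point.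
  Hence the sum is at most \<open>N\<close> times the integral of g^p. Sparseness relative to
  \<open>M\<close> itself is not assumed, which lets the same sets serve both weighted
  measures.\<close>

lemma laminar_carleson_embedding:
  fixes h :: "'a \<Rightarrow> real"
  assumes p: "1 < p" "1 < q" "1/p + 1/q = 1"
    and S: "finite S" "laminar S" "S \<subseteq> sets M" "\<And>Q. Q \<in> S \<Longrightarrow> emeasure M Q < \<infinity>"
    and [measurable]: "h \<in> borel_measurable M" and h0: "\<And>x. 0 \<le> h x" and A: "0 \<le> A"
    and hA: "(\<integral>\<^sup>+x. ennreal (h x powr p) \<partial>M) \<le> ennreal A"
    and E: "\<And>Q. Q \<in> S \<Longrightarrow> E Q \<subseteq> Q" "\<And>Q. Q \<in> S \<Longrightarrow> E Q \<in> sets M"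
    and N: "\<And>x. card {Q\<in>S. x \<in> E Q} \<le> N"
  shows "(\<Sum>Q\<in>S. (enn2real (\<integral>\<^sup>+x\<in>Q. ennreal (h x) \<partial>M) / measure M Q) powr p * measure M (E Q))
      \<le> real N * (q powr p * A)"
proof -
  let ?c = "\<lambda>Q. enn2real (\<integral>\<^sup>+x\<in>Q. ennreal (h x) \<partial>M) / measure M Q"
  obtain g :: "'a \<Rightarrow> real" where [measurable]: "g \<in> borel_measurable M" and g0: "\<And>x. 0 \<le> g x"
    and g_ge: "\<And>Q x. Q \<in> S \<Longrightarrow> x \<in> Q \<Longrightarrow> ?c Q \<le> g x"
    and gA: "(\<integral>\<^sup>+x. ennreal (g x powr p) \<partial>M) \<le> ennreal (q powr p * A)"
    using laminar_maximal_function[OF p S \<open>h \<in> borel_measurable M\<close> h0 A hA] by blast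
  have E_fin: "emeasure M (E Q) = ennreal (measure M (E Q))" if "Q \<in> S" for Q
  proof -
    have "emeasure M (E Q) \<le> emeasure M Q"
      using E(1)[OF that] S(3) that by (intro emeasure_mono) auto
    then show ?thesis
      using S(4)[OF that] by (intro emeasure_eq_ennreal_measure) (auto simp: top_unique)
  qed
  have pt: "(\<Sum>Q\<in>S. ?c Q powr p * indicator (E Q) x) \<le> real N * g x powr p" for x
  proof -
    have "(\<Sum>Q\<in>S. ?c Q powr p * indicator (E Q) x) = (\<Sum>Q\<in>{Q\<in>S. x \<in> E Q}. ?c Q powr p)"
      using S(1) by (intro sum.mono_neutral_cong_right) (auto simp: indicator_def)
    also have "\<dots> \<le> (\<Sum>Q\<in>{Q\<in>S. x \<in> E Q}. g x powr p)"
      using p E(1) by (intro sum_mono powr_mono2 g_ge) auto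
    also have "\<dots> = real (card {Q\<in>S. x \<in> E Q}) * g x powr p" by simp
    also have "\<dots> \<le> real N * g x powr p" using N by (intro mult_right_mono) auto
    finally show ?thesis .
  qed
  have "ennreal (\<Sum>Q\<in>S. ?c Q powr p * measure M (E Q)) = (\<Sum>Q\<in>S. ennreal (?c Q powr p) * emeasure M (E Q))"
    using E_fin by (simp add: sum_ennreal[symmetric] ennreal_mult' del: sum_ennreal)
  also have "\<dots> = (\<integral>\<^sup>+x. (\<Sum>Q\<in>S. ennreal (?c Q powr p) * indicator (E Q) x) \<partial>M)"
    using E(2) by (simp add: nn_integral_sum nn_integral_cmult)
  also have "\<dots> = (\<integral>\<^sup>+x. ennreal (\<Sum>Q\<in>S. ?c Q powr p * indicator (E Q) x) \<partial>M)"
    by (intro nn_integral_cong)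
       (simp add: sum_ennreal[symmetric] ennreal_mult' ennreal_indicator del: sum_ennreal)
  also have "\<dots> \<le> (\<integral>\<^sup>+x. ennreal (real N) * ennreal (g x powr p) \<partial>M)"
    by (intro nn_integral_mono) (simp add: pt ennreal_leI flip: ennreal_mult)
  also have "\<dots> = ennreal (real N) * (\<integral>\<^sup>+x. ennreal (g x powr p) \<partial>M)"
    by (rule nn_integral_cmult) measurable
  also have "\<dots> \<le> ennreal (real N) * ennreal (q powr p * A)"
    by (intro mult_left_mono gA) auto
  also have "\<dots> = ennreal (real N * (q powr p * A))"
    using A by (intro ennreal_mult[symmetric]) auto
  finally show ?thesis using A by (subst (asm) ennreal_le_iff) auto
qed

section \<open>Weighted bounds for sparse operators\<close>

text \<open>For a cube, \<open>m\<close> stands for its \<open>mu_lam\<close>-measure and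
  \<open>X\<close>, \<open>Y\<close> for its masses under the weight and the dual weight;
  \<open>e\<close>, \<open>x\<close>, \<open>y\<close> are the same quantities for its sparse part.
  The condition \<open>Ap\<close> controls X Y^(p-1), and the remaining power Y^(2-p) and the mass
  \<open>m\<close> are passed from the cube to its sparse part.\<close>

lemma sparse_form_coefficient_le:
  fixes p q :: real
  assumes p: "1 < p" "1 < q" "1/p + 1/q = 1" "2 \<le> p" and L: "0 < \<Lambda>" and m: "0 < m" and K: "0 \<le> K"
    and e: "\<Lambda> * m \<le> e" "e \<le> x powr (1/p) * y powr (1/q)"
    and xy: "0 \<le> x" "0 \<le> y" "y \<le> Y"
    and Ap: "X * Y powr (p - 1) \<le> K * m powr p"
  shows "X * Y / m \<le> \<Lambda> powr (1 - p) * K * (y powr (1/p) * x powr (1/q))"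
proof -
  have "0 < x powr (1/p) * y powr (1/q)" using e m L by (meson less_le_trans mult_pos_pos)
  then have x0: "x > 0" and y0: "y > 0" using xy by (auto simp: zero_less_mult_iff)
  have Y0: "Y > 0" using y0 xy by simp
  have "m \<le> x powr (1/p) * y powr (1/q) / \<Lambda>" using e L by (simp add: field_simps)
  then have "m powr (p-1) \<le> (x powr (1/p) * y powr (1/q) / \<Lambda>) powr (p-1)"
    using m p by (intro powr_mono2) auto
  also have "\<dots> = \<Lambda> powr (1-p) * (x powr ((p-1)/p) * y powr ((p-1)/q))"
    using L x0 y0 powr_minus_divide[of \<Lambda> "p-1"] by (simp add: powr_divide powr_mult powr_powr)
  finally have m1: "m powr (p-1) \<le> \<Lambda> powr (1-p) * (x powr ((p-1)/p) * y powr ((p-1)/q))" .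
  have ex: "(p-1)/p = 1/q" using conjugate_exponent_facts(3)[OF p(1-3)] p by (simp add: diff_divide_distrib)
  have "(p-1)/q = (p-1) * (1 - 1/p)" using conjugate_exponent_facts(3)[OF p(1-3)] by (metis times_divide_eq_right mult.right_neutral)
  also have "\<dots> = p - 2 + 1/p" using p(1) by (simp add: field_simps)
  finally have ey: "(p-1)/q + (2-p) = 1/p" by simp
  have "X * Y = X * Y powr (p-1) * Y powr (2-p)"
    using Y0 by (simp add: mult.assoc flip: powr_add)
  also have "\<dots> \<le> K * m powr p * Y powr (2-p)" by (intro mult_right_mono Ap) auto
  \<comment> \<open>Here p \<ge> 2 is decisive: the exponent 2 - p is nonpositive, so replacing
    \<open>Y\<close> by the smaller \<open>y\<close> increases the power.\<close>
  also have "\<dots> \<le> K * m powr p * y powr (2-p)"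
    using K y0 xy p by (intro mult_left_mono powr_mono2') auto
  finally have "X * Y / m \<le> K * m powr p * y powr (2-p) / m" using m by (intro divide_right_mono) auto
  also have "\<dots> = K * m powr (p-1) * y powr (2-p)" using m by (simp add: powr_diff)
  also have "\<dots> \<le> K * (\<Lambda> powr (1-p) * (x powr ((p-1)/p) * y powr ((p-1)/q))) * y powr (2-p)"
    using K by (intro mult_right_mono mult_left_mono m1) auto
  also have "\<dots> = \<Lambda> powr (1-p) * K * (y powr ((p-1)/q + (2-p)) * x powr ((p-1)/p))"
    by (simp add: powr_add mult_ac)
  finally show ?thesis unfolding ex ey .
qed

text \<open>Each term is a product of two averages and a coefficient. The coefficient bound splits
  into one factor for each average, making the term a multiple of \<open>a Q * b Q\<close>. Hoelder
  for sums separates these, and the Carleson embedding, under \<open>G\<close> with exponent p and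
  under \<open>V\<close> with exponent q, bounds the two sums. The maximal constants contribute
  \<open>q\<close> and \<open>p\<close>, the overlap contributes \<open>N\<close>.\<close>

lemma sparse_form_bound:
  fixes h g :: "'a \<Rightarrow> real" and m e :: "'a set \<Rightarrow> real"
  assumes p: "1 < p" "1 < q" "1/p + 1/q = 1" "2 \<le> p"
    and S: "finite S" "laminar S" "S \<subseteq> sets V" and VG: "sets G = sets V"
    and fin: "\<And>Q. Q \<in> S \<Longrightarrow> emeasure V Q < \<infinity>" "\<And>Q. Q \<in> S \<Longrightarrow> emeasure G Q < \<infinity>"
    and E: "\<And>Q. Q \<in> S \<Longrightarrow> E Q \<subseteq> Q" "\<And>Q. Q \<in> S \<Longrightarrow> E Q \<in> sets V"
    and N: "\<And>x. card {Q\<in>S. x \<in> E Q} \<le> N"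
    and L: "0 < \<Lambda>" and K: "0 \<le> K" and m: "\<And>Q. Q \<in> S \<Longrightarrow> 0 < m Q"
    and e: "\<And>Q. Q \<in> S \<Longrightarrow> \<Lambda> * m Q \<le> e Q"
      "\<And>Q. Q \<in> S \<Longrightarrow> e Q \<le> measure V (E Q) powr (1/p) * measure G (E Q) powr (1/q)"
    and Ap: "\<And>Q. Q \<in> S \<Longrightarrow> measure V Q * measure G Q powr (p - 1) \<le> K * m Q powr p"
    and h: "h \<in> borel_measurable G" "\<And>x. 0 \<le> h x" "0 \<le> A"
      "(\<integral>\<^sup>+x. ennreal (h x powr p) \<partial>G) \<le> ennreal A"
    and g: "g \<in> borel_measurable V" "\<And>x. 0 \<le> g x" "0 \<le> B"
      "(\<integral>\<^sup>+x. ennreal (g x powr q) \<partial>V) \<le> ennreal B"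
  shows "(\<Sum>Q\<in>S. enn2real (\<integral>\<^sup>+x\<in>Q. ennreal (h x) \<partial>G) * enn2real (\<integral>\<^sup>+x\<in>Q. ennreal (g x) \<partial>V) / m Q)
    \<le> \<Lambda> powr (1 - p) * (real N * p * q) * K * A powr (1/p) * B powr (1/q)"
proof -
  let ?IG = "\<lambda>Q. enn2real (\<integral>\<^sup>+x\<in>Q. ennreal (h x) \<partial>G)"
  let ?IV = "\<lambda>Q. enn2real (\<integral>\<^sup>+x\<in>Q. ennreal (g x) \<partial>V)"
  define a where "a Q = ?IG Q / measure G Q * measure G (E Q) powr (1/p)" for Q
  define b where "b Q = ?IV Q / measure V Q * measure V (E Q) powr (1/q)" for Q
  have q': "1/q + 1/p = 1" using p by simp
  have tm: "?IG Q * ?IV Q / m Q \<le> \<Lambda> powr (1-p) * K * (a Q * b Q)" if Q: "Q \<in> S" for Q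
  proof -
    have EQ: "measure V (E Q) \<le> measure V Q" "measure G (E Q) \<le> measure G Q"
      using E[OF Q] S(3) Q VG fin[OF Q] by (auto intro!: measure_mono_fmeasurable simp: fmeasurable_def)
    \<comment> \<open>Positivity of both masses makes the divisions in \<open>a\<close> and
      \<open>b\<close> genuine, so multiplying and dividing by them is legitimate.\<close>
    have "0 < measure V (E Q) powr (1/p) * measure G (E Q) powr (1/q)"
      using e[OF Q] m[OF Q] L by (meson less_le_trans mult_pos_pos)
    then have "0 < measure V (E Q)" "0 < measure G (E Q)" by (auto simp: zero_less_mult_iff zero_less_measure_iff)
    then have pos: "0 < measure V Q" "0 < measure G Q" using EQ by auto
    have "?IG Q * ?IV Q / m Q = ?IG Q / measure G Q * (?IV Q / measure V Q) * (measure V Q * measure G Q / m Q)"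
      using pos by simp
    also have "\<dots> \<le> ?IG Q / measure G Q * (?IV Q / measure V Q) *
        (\<Lambda> powr (1-p) * K * (measure G (E Q) powr (1/p) * measure V (E Q) powr (1/q)))"
      by (intro mult_left_mono sparse_form_coefficient_le[OF p L m[OF Q] K e(1)[OF Q] e(2)[OF Q] _ _ EQ(2) Ap[OF Q]]) auto
    finally show ?thesis by (simp add: a_def b_def mult_ac)
  qed
  have 1: "(\<Sum>Q\<in>S. a Q powr p) \<le> real N * (q powr p * A)"
  proof -
    have "(\<Sum>Q\<in>S. a Q powr p) = (\<Sum>Q\<in>S. (?IG Q / measure G Q) powr p * measure G (E Q))"
      using p(1) unfolding a_def powr_mult powr_powr by simp
    also have "\<dots> \<le> real N * (q powr p * A)"
      by (rule laminar_carleson_embedding[OF p(1-3) S(1,2) _ fin(2) h E(1) _ N]) (use S E VG in auto)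
    finally show ?thesis .
  qed
  have 2: "(\<Sum>Q\<in>S. b Q powr q) \<le> real N * (p powr q * B)"
  proof -
    have "(\<Sum>Q\<in>S. b Q powr q) = (\<Sum>Q\<in>S. (?IV Q / measure V Q) powr q * measure V (E Q))"
      using p(2) unfolding b_def powr_mult powr_powr by simp
    also have "\<dots> \<le> real N * (p powr q * B)"
      by (rule laminar_carleson_embedding[OF p(2,1) q' S fin(1) g E(1) _ N]) (use S E VG in auto)
    finally show ?thesis .
  qed
  have "(\<Sum>Q\<in>S. ?IG Q * ?IV Q / m Q) \<le> \<Lambda> powr (1-p) * K * (\<Sum>Q\<in>S. a Q * b Q)"
    unfolding sum_distrib_left by (intro sum_mono tm)
  also have "\<dots> \<le> \<Lambda> powr (1-p) * K * ((\<Sum>Q\<in>S. a Q powr p) powr (1/p) * (\<Sum>Q\<in>S. b Q powr q) powr (1/q))"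
    using K by (intro mult_left_mono sum_Holder[OF p(1-3) S(1)]) (auto simp: a_def b_def)
  also have "\<dots> \<le> \<Lambda> powr (1-p) * K * ((real N * (q powr p * A)) powr (1/p) * (real N * (p powr q * B)) powr (1/q))"
    using K p(1,2) by (intro mult_left_mono mult_mono powr_mono2 1 2) (auto intro!: sum_nonneg)
  also have "\<dots> = \<Lambda> powr (1-p) * K * ((real N powr (1/p) * real N powr (1/q)) * p * q * A powr (1/p) * B powr (1/q))"
    using p(1,2) h(3) g(3) by (simp add: powr_mult powr_powr mult_ac)
  also have "real N powr (1/p) * real N powr (1/q) = real N"
    using p by (simp flip: powr_add)
  finally show ?thesis by (simp add: mult_ac)
qed

text \<open>Testing the bilinear form against \<open>F powr (p - 1)\<close> replaces duality: \<open>F\<close> has finite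
  norm because \<open>S\<close> is finite, so the norm can be absorbed.\<close>

lemma nn_integral_powr_le_of_form_bound:
  fixes a :: "'a set \<Rightarrow> real"
  assumes p: "1 < p" "1 < q" "1/p + 1/q = 1"
    and S: "finite S" "S \<subseteq> sets V" "\<And>Q. Q \<in> S \<Longrightarrow> emeasure V Q < \<infinity>"
    and a: "\<And>Q. Q \<in> S \<Longrightarrow> 0 \<le> a Q"
    and form: "\<And>g B. g \<in> borel_measurable V \<Longrightarrow> (\<And>x. 0 \<le> g x) \<Longrightarrow> 0 \<le> B \<Longrightarrow>
      (\<integral>\<^sup>+x. ennreal (g x powr q) \<partial>V) \<le> ennreal B \<Longrightarrow>
      (\<Sum>Q\<in>S. a Q * enn2real (\<integral>\<^sup>+x\<in>Q. ennreal (g x) \<partial>V)) \<le> c * B powr (1/q)"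
  shows "(\<integral>\<^sup>+x. ennreal ((\<Sum>Q\<in>S. a Q * indicator Q x) powr p) \<partial>V) \<le> ennreal (c powr p)"
proof -
  define F where "F x = (\<Sum>Q\<in>S. a Q * indicator Q x)" for x
  define T where "T = (\<Sum>Q\<in>S. a Q)"
  define X where "X = (\<integral>\<^sup>+x. ennreal (F x powr p) \<partial>V)"
  have Qm[measurable]: "Q \<in> sets V" if "Q \<in> S" for Q using S(2) that by auto
  have Fm[measurable]: "F \<in> borel_measurable V" unfolding F_def by measurable
  have F0: "0 \<le> F x" for x unfolding F_def using a by (auto intro!: sum_nonneg)
  have FT: "F x \<le> T" for x
    unfolding F_def T_def using a by (intro sum_mono) (auto split: split_indicator)
  have Fp: "F x powr p = F x * F x powr (p-1)" for x
    using powr_mult_base[OF F0, of x "p-1"] by simp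
  have int_F: "(\<integral>\<^sup>+x. ennreal (F x * k x) \<partial>V) = (\<Sum>Q\<in>S. ennreal (a Q) * (\<integral>\<^sup>+x\<in>Q. ennreal (k x) \<partial>V))"
    if [measurable]: "k \<in> borel_measurable V" and k0: "\<And>x. 0 \<le> k x" for k
  proof -
    have "ennreal (F x * k x) = (\<Sum>Q\<in>S. ennreal (a Q) * (ennreal (k x) * indicator Q x))" for x
    proof -
      have "F x * k x = (\<Sum>Q\<in>S. a Q * (k x * indicator Q x))"
        unfolding F_def sum_distrib_right by (simp add: mult_ac)
      also have "ennreal \<dots> = (\<Sum>Q\<in>S. ennreal (a Q * (k x * indicator Q x)))"
        using a k0 by (intro sum_ennreal[symmetric]) auto
      also have "\<dots> = (\<Sum>Q\<in>S. ennreal (a Q) * (ennreal (k x) * indicator Q x))"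
        using a k0 by (intro sum.cong refl) (auto simp: ennreal_mult split: split_indicator)
      finally show ?thesis .
    qed
    then show ?thesis by (simp add: nn_integral_sum nn_integral_cmult)
  qed
  \<comment> \<open>\<open>F\<close> is bounded by the sum \<open>T\<close> of all coefficients and
    is supported on finitely many sets of finite measure, so \<open>X\<close> is finite.\<close>
  have "X \<le> (\<integral>\<^sup>+x. ennreal (F x * T powr (p-1)) \<partial>V)"
    unfolding X_def Fp using F0 FT p
    by (intro nn_integral_mono ennreal_leI mult_left_mono powr_mono2) auto
  also have "\<dots> = (\<Sum>Q\<in>S. ennreal (a Q) * (\<integral>\<^sup>+x\<in>Q. ennreal (T powr (p-1)) \<partial>V))"
    by (rule int_F) auto
  also have "\<dots> = (\<Sum>Q\<in>S. ennreal (a Q) * (ennreal (T powr (p-1)) * emeasure V Q))"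
    by (simp add: nn_integral_cmult)
  also have "\<dots> < \<infinity>" using S by (simp add: ennreal_mult_less_top)
  finally have X_fin: "X = ennreal (enn2real X)" by simp
  let ?g = "\<lambda>x. F x powr (p-1)"
  \<comment> \<open>Since (p-1) q = p, the test function has q-th power integral equal to
    \<open>X\<close> itself.\<close>
  have gq: "(\<integral>\<^sup>+x. ennreal (?g x powr q) \<partial>V) \<le> ennreal (enn2real X)"
    using X_fin conjugate_exponent_facts(1)[OF p] by (simp add: powr_powr X_def)
  have q': "1/q + 1/p = 1" using p by simp
  have Ig: "(\<integral>\<^sup>+x\<in>Q. ennreal (?g x) \<partial>V) = ennreal (enn2real (\<integral>\<^sup>+x\<in>Q. ennreal (?g x) \<partial>V))" if "Q \<in> S" for Q
  proof -
    have "(\<integral>\<^sup>+x\<in>Q. ennreal (?g x) \<partial>V) \<le> ennreal (enn2real X powr (1/q) * measure V Q powr (1/p))"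
      by (rule nn_set_integral_Holder[OF p(2,1) q' _ _ _ gq]) (use S that in auto)
    then show ?thesis by (metis ennreal_enn2real_if ennreal_neq_top neq_top_trans)
  qed
  have "X = (\<Sum>Q\<in>S. ennreal (a Q) * (\<integral>\<^sup>+x\<in>Q. ennreal (?g x) \<partial>V))"
    unfolding X_def Fp by (rule int_F) auto
  also have "\<dots> = (\<Sum>Q\<in>S. ennreal (a Q * enn2real (\<integral>\<^sup>+x\<in>Q. ennreal (?g x) \<partial>V)))"
    using a Ig by (intro sum.cong refl) (simp add: ennreal_mult)
  also have "\<dots> = ennreal (\<Sum>Q\<in>S. a Q * enn2real (\<integral>\<^sup>+x\<in>Q. ennreal (?g x) \<partial>V))"
    using a by (intro sum_ennreal) auto
  finally have "enn2real X = (\<Sum>Q\<in>S. a Q * enn2real (\<integral>\<^sup>+x\<in>Q. ennreal (?g x) \<partial>V))"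
    using a by (simp add: sum_nonneg)
  also have "\<dots> \<le> c * enn2real X powr (1/q)"
    by (rule form[OF _ _ _ gq]) auto
  finally have "enn2real X \<le> c powr p" by (rule le_powr_of_le_self_powr[OF p, rotated]) auto
  then have "ennreal (enn2real X) \<le> ennreal (c powr p)" by (rule ennreal_leI)
  then have "X \<le> ennreal (c powr p)" by (simp only: X_fin[symmetric])
  then show ?thesis unfolding X_def F_def .
qed

text \<open>The form bound requires an exponent at least 2, so for p < 2 it is applied to q with the
  two measures exchanged. Adding the two powers of \<open>\<Lambda>\<close> yields one constant
  valid in both cases.\<close>

lemma finite_sparse_operator_bound:
  fixes h :: "'a \<Rightarrow> real" and m e :: "'a set \<Rightarrow> real"
  assumes p: "1 < p" "1 < q" "1/p + 1/q = 1"
    and S: "finite S" "laminar S" "S \<subseteq> sets V" and VG: "sets G = sets V"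
    and fin: "\<And>Q. Q \<in> S \<Longrightarrow> emeasure V Q < \<infinity>" "\<And>Q. Q \<in> S \<Longrightarrow> emeasure G Q < \<infinity>"
    and E: "\<And>Q. Q \<in> S \<Longrightarrow> E Q \<subseteq> Q" "\<And>Q. Q \<in> S \<Longrightarrow> E Q \<in> sets V"
    and N: "\<And>x. card {Q\<in>S. x \<in> E Q} \<le> N"
    and L: "0 < \<Lambda>" and K: "0 \<le> K" and m: "\<And>Q. Q \<in> S \<Longrightarrow> 0 < m Q"
    and e: "\<And>Q. Q \<in> S \<Longrightarrow> \<Lambda> * m Q \<le> e Q"
      "\<And>Q. Q \<in> S \<Longrightarrow> e Q \<le> measure V (E Q) powr (1/p) * measure G (E Q) powr (1/q)"
    and Ap: "\<And>Q. Q \<in> S \<Longrightarrow> measure V Q * measure G Q powr (p - 1) \<le> K * m Q powr p"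
    and h: "h \<in> borel_measurable G" "\<And>x. 0 \<le> h x" "0 \<le> A"
      "(\<integral>\<^sup>+x. ennreal (h x powr p) \<partial>G) \<le> ennreal A"
  shows "(\<integral>\<^sup>+x. ennreal ((\<Sum>Q\<in>S. enn2real (\<integral>\<^sup>+x\<in>Q. ennreal (h x) \<partial>G) / m Q * indicator Q x) powr p) \<partial>V)
    \<le> ennreal (((\<Lambda> powr (1 - p) + \<Lambda> powr (1 - q)) * (real N * p * q) * K powr (max 1 (1/(p-1)))) powr p * A)"
proof -
  define c where "c = (\<Lambda> powr (1 - p) + \<Lambda> powr (1 - q)) * (real N * p * q) * K powr (max 1 (1/(p-1)))"
  have c0: "0 \<le> c" using p(1,2) by (simp add: c_def)
  have "(\<integral>\<^sup>+x. ennreal ((\<Sum>Q\<in>S. enn2real (\<integral>\<^sup>+x\<in>Q. ennreal (h x) \<partial>G) / m Q * indicator Q x) powr p) \<partial>V)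
    \<le> ennreal ((c * A powr (1/p)) powr p)"
  proof (rule nn_integral_powr_le_of_form_bound[OF p S(1,3) fin(1)])
    fix g :: "'a \<Rightarrow> real" and B :: real
    assume g: "g \<in> borel_measurable V" "\<And>x. 0 \<le> g x" "0 \<le> B"
      "(\<integral>\<^sup>+x. ennreal (g x powr q) \<partial>V) \<le> ennreal B"
    let ?IG = "\<lambda>Q. enn2real (\<integral>\<^sup>+x\<in>Q. ennreal (h x) \<partial>G)"
    let ?IV = "\<lambda>Q. enn2real (\<integral>\<^sup>+x\<in>Q. ennreal (g x) \<partial>V)"
    have "(\<Sum>Q\<in>S. ?IG Q * ?IV Q / m Q) \<le> c * A powr (1/p) * B powr (1/q)"
    proof (cases "2 \<le> p")
      case True
      then have "max 1 (1/(p-1)) = 1" by (simp add: max_def field_simps)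
      then have "K powr (max 1 (1/(p-1))) = K" using K by simp
      then have cc: "\<Lambda> powr (1 - p) * (real N * p * q) * K \<le> c"
        unfolding c_def using K p(1,2) by (simp add: mult_right_mono)
      have "(\<Sum>Q\<in>S. ?IG Q * ?IV Q / m Q) \<le> \<Lambda> powr (1 - p) * (real N * p * q) * K * A powr (1/p) * B powr (1/q)"
        by (rule sparse_form_bound[OF p True S VG fin E N L K m e Ap h g])
      also have "\<dots> \<le> c * A powr (1/p) * B powr (1/q)"
        using cc by (intro mult_right_mono) auto
      finally show ?thesis .
    next
      case False
      then have p2: "p < 2" by simp
      have q': "1/q + 1/p = 1" using p by simp
      have q1: "q - 1 = 1/(p-1)" using conjugate_exponent_facts(1)[OF p] p(1) by (simp add: field_simps)
      have q2: "2 \<le> q" using q1 p2 p(1) by (smt (verit) le_divide_eq_1)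
      have mx: "max 1 (1/(p-1)) = q - 1" using q1 q2 by simp
      have cc: "\<Lambda> powr (1 - q) * (real N * q * p) * K powr (q-1) \<le> c"
        unfolding c_def mx using K p(1,2) by (intro mult_right_mono) (auto simp: mult_ac intro!: mult_left_mono)
      \<comment> \<open>Raising the condition to the power q - 1 gives the dual condition, because
        (p-1)(q-1) = 1 and p (q-1) = q. The constant becomes K^(q-1) = K^(1/(p-1)), the source of
        the second exponent in the maximum.\<close>
      have Ap': "measure G Q * measure V Q powr (q - 1) \<le> K powr (q-1) * m Q powr q" if "Q \<in> S" for Q
      proof -
        have "(measure V Q * measure G Q powr (p - 1)) powr (q-1) \<le> (K * m Q powr p) powr (q-1)"
          using Ap[OF that] p by (intro powr_mono2) auto
        moreover have "(p-1) * (q-1) = 1" using q1 p(1) by simp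
        ultimately show ?thesis
          using K conjugate_exponent_facts(2)[OF p] by (simp add: powr_mult powr_powr mult_ac)
      qed
      have "(\<Sum>Q\<in>S. ?IV Q * ?IG Q / m Q)
        \<le> \<Lambda> powr (1 - q) * (real N * q * p) * K powr (q-1) * B powr (1/q) * A powr (1/p)"
        by (rule sparse_form_bound[OF p(2,1) q' q2 S(1,2) _ VG[symmetric] fin(2,1) E(1) _ N L _ m e(1) _ Ap' g h])
           (use S E VG e(2) in \<open>auto simp: mult.commute\<close>)
      also have "\<dots> \<le> c * B powr (1/q) * A powr (1/p)"
        using cc by (intro mult_right_mono) auto
      finally show ?thesis by (simp add: mult_ac)
    qed
    then show "(\<Sum>Q\<in>S. ?IG Q / m Q * ?IV Q) \<le> c * A powr (1/p) * B powr (1/q)" by simp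
  qed (auto intro!: divide_nonneg_pos m)
  also have "(c * A powr (1/p)) powr p = c powr p * A"
    using c0 h(3) p(1) by (simp add: powr_mult powr_powr)
  finally show ?thesis unfolding c_def .
qed

section \<open>From finite to countable families\<close>

lemma countable_sum_indicator_powr_bound:
  fixes c :: "'a set \<Rightarrow> real" and W :: "'a \<Rightarrow> real"
  assumes p: "1 < p" and S: "countable S" "S \<subseteq> sets M" and c: "\<And>Q. Q \<in> S \<Longrightarrow> 0 \<le> c Q"
    and W[measurable]: "W \<in> borel_measurable M" and W0: "\<And>x. 0 \<le> W x"
    and bound: "\<And>T. finite T \<Longrightarrow> T \<subseteq> S \<Longrightarrow>
      (\<integral>\<^sup>+x. ennreal (W x * (\<Sum>Q\<in>T. c Q * indicator Q x) powr p) \<partial>M) \<le> ennreal R"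
  shows "AE x in M. 0 < W x \<longrightarrow> (\<lambda>Q. c Q * indicator Q x) summable_on S"
    and "(\<integral>\<^sup>+x. ennreal (W x * (\<Sum>\<^sub>\<infinity>Q\<in>S. c Q * indicator Q x) powr p) \<partial>M) \<le> ennreal R"
proof -
  \<comment> \<open>Unordered sums offer no sequence of partial sums; an increasing exhaustion by
    finite families makes monotone convergence applicable. The empty family is separate since it
    cannot be enumerated.\<close>
  obtain T :: "nat \<Rightarrow> 'a set set" where T: "incseq T" "\<And>n. finite (T n)" "(\<Union>n. T n) = S"
  proof (cases "S = {}")
    case True
    then show thesis using that[of "\<lambda>_. {}"] by (auto simp: incseq_def)
  next
    case False
    show thesis
    proof (rule that[of "\<lambda>n. from_nat_into S ` {..n}"])
      show "incseq (\<lambda>n. from_nat_into S ` {..n})"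
        unfolding incseq_def by (auto intro!: image_mono)
      have "(\<Union>n. from_nat_into S ` {..n}) = range (from_nat_into S)" by auto
      then show "(\<Union>n. from_nat_into S ` {..n}) = S" using False S(1) by (simp add: range_from_nat_into)
    qed auto
  qed
  have TS: "T n \<subseteq> S" for n using T(3) by blast
  define F where "F n x = (\<Sum>Q\<in>T n. c Q * indicator Q x)" for n x
  define U where "U x = (SUP n. ennreal (W x * F n x powr p))" for x
  have [measurable]: "Q \<in> sets M" if "Q \<in> T n" for n Q using that TS S(2) by blast
  have Fm[measurable]: "F n \<in> borel_measurable M" for n unfolding F_def by measurable
  have sum0: "0 \<le> (\<Sum>Q\<in>T'. c Q * indicator Q x)" if "T' \<subseteq> S" for T' x
    using that c by (intro sum_nonneg mult_nonneg_nonneg) auto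
  have F_mono: "(\<Sum>Q\<in>T'. c Q * indicator Q x) \<le> F n x" if "T' \<subseteq> T n" for T' n x
    unfolding F_def using that T(2) TS[of n] c by (intro sum_mono2) (auto intro!: mult_nonneg_nonneg)
  have inc: "incseq (\<lambda>n x. ennreal (W x * F n x powr p))"
  proof (intro incseq_SucI le_funI ennreal_leI mult_left_mono powr_mono2)
    fix n x
    have "T n \<subseteq> T (Suc n)" using T(1) by (simp add: incseq_SucD)
    then show "F n x \<le> F (Suc n) x" using F_mono[of "T n" "Suc n" x] by (simp add: F_def)
  qed (use p W0 sum0 TS in \<open>auto simp: F_def\<close>)
  have UR: "(\<integral>\<^sup>+x. U x \<partial>M) \<le> ennreal R"
  proof -
    have "(\<integral>\<^sup>+x. U x \<partial>M) = (SUP n. (\<integral>\<^sup>+x. ennreal (W x * F n x powr p) \<partial>M))"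
      unfolding U_def by (rule nn_integral_monotone_convergence_SUP[OF inc]) measurable
    also have "\<dots> \<le> ennreal R"
      unfolding F_def by (intro SUP_least bound T TS)
    finally show ?thesis .
  qed
  have U_fin: "AE x in M. U x \<noteq> \<infinity>"
  proof (rule nn_integral_noteq_infinite)
    show "U \<in> borel_measurable M" unfolding U_def by measurable
    show "integral\<^sup>N M U \<noteq> \<infinity>" using UR by (auto simp: top_unique)
  qed
  \<comment> \<open>Where the supremum \<open>U x\<close> is finite and \<open>W x\<close> is
    positive, it bounds all finite partial sums uniformly. This yields summability and the bound on
    the sum together.\<close>
  have key: "(\<lambda>Q. c Q * indicator Q x) summable_on S \<and>
      ennreal (W x * (\<Sum>\<^sub>\<infinity>Q\<in>S. c Q * indicator Q x) powr p) \<le> U x"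
    if "U x \<noteq> \<infinity>" and Wx: "0 < W x" for x
  proof -
    define l where "l = enn2real (U x)"
    have l: "U x = ennreal l" "0 \<le> l" using that by (auto simp: l_def less_top)
    have bd: "(\<Sum>Q\<in>T'. c Q * indicator Q x) \<le> (l / W x) powr (1/p)" if T': "finite T'" "T' \<subseteq> S" for T'
    proof -
      have "\<exists>n. T' \<subseteq> T n"
        using T'
      proof (induction T')
        case (insert Q T')
        then obtain n where n: "T' \<subseteq> T n" by auto
        obtain k where k: "Q \<in> T k" using insert.prems T(3) by auto
        have "T n \<subseteq> T (max n k)" "T k \<subseteq> T (max n k)" using T(1) by (simp_all add: incseqD)
        then show ?case using n k by blast
      qed auto
      then obtain n where n: "T' \<subseteq> T n" ..
      have "ennreal (W x * F n x powr p) \<le> ennreal l"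
        unfolding l(1)[symmetric] U_def by (rule SUP_upper) simp
      then have "W x * F n x powr p \<le> l" using l(2) by (simp add: ennreal_le_iff)
      then have "F n x powr p \<le> l / W x" using Wx by (simp add: field_simps)
      then have "(F n x powr p) powr (1/p) \<le> (l / W x) powr (1/p)"
        using p by (intro powr_mono2) auto
      moreover have "0 \<le> F n x" unfolding F_def using sum0[OF TS] .
      ultimately have "F n x \<le> (l / W x) powr (1/p)" using p by (simp add: powr_powr)
      then show ?thesis using F_mono[OF n, of x] by linarith
    qed
    have sm: "(\<lambda>Q. c Q * indicator Q x) summable_on S"
      by (rule nonneg_bdd_above_summable_on) (use c bd in \<open>auto simp: bdd_above_def\<close>)
    have "(\<Sum>\<^sub>\<infinity>Q\<in>S. c Q * indicator Q x) \<le> (l / W x) powr (1/p)"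
      by (rule infsum_le_finite_sums[OF sm bd])
    moreover have "0 \<le> (\<Sum>\<^sub>\<infinity>Q\<in>S. c Q * indicator Q x)" using c by (intro infsum_nonneg) auto
    ultimately have "(\<Sum>\<^sub>\<infinity>Q\<in>S. c Q * indicator Q x) powr p \<le> ((l / W x) powr (1/p)) powr p"
      using p by (intro powr_mono2) auto
    also have "\<dots> = l / W x" using p l(2) Wx by (simp add: powr_powr)
    finally have "W x * (\<Sum>\<^sub>\<infinity>Q\<in>S. c Q * indicator Q x) powr p \<le> l" using Wx by (simp add: field_simps)
    then show ?thesis using sm unfolding l(1) by (simp add: ennreal_leI)
  qed
  show "AE x in M. 0 < W x \<longrightarrow> (\<lambda>Q. c Q * indicator Q x) summable_on S"
    using U_fin by eventually_elim (use key in blast)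
  have "(\<integral>\<^sup>+x. ennreal (W x * (\<Sum>\<^sub>\<infinity>Q\<in>S. c Q * indicator Q x) powr p) \<partial>M) \<le> (\<integral>\<^sup>+x. U x \<partial>M)"
    using U_fin
  proof (intro nn_integral_mono_AE, eventually_elim)
    case (elim x)
    \<comment> \<open>Where \<open>W x\<close> = 0 summability is unknown, but the integrand
      vanishes whatever value the infinite sum has.\<close>
    then show ?case using key[of x] W0[of x] by (cases "W x = 0") (auto simp: less_le)
  qed
  then show "(\<integral>\<^sup>+x. ennreal (W x * (\<Sum>\<^sub>\<infinity>Q\<in>S. c Q * indicator Q x) powr p) \<partial>M) \<le> ennreal R"
    using UR by (rule order_trans)
qed

section \<open>The Bessel measure and dyadic cubes\<close>

lemma sets_mu_lam [measurable_cong, simp]: "sets (mu_lam lam) = sets borel"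
  by (simp add: mu_lam_def)

lemma emeasure_mu_lam:
  assumes [measurable]: "Q \<in> sets borel"
  shows "emeasure (mu_lam lam) Q = (\<integral>\<^sup>+x\<in>Q. ennreal (indicator {0<..} x * x powr (2 * lam)) \<partial>lborel)"
  unfolding mu_lam_def by (subst emeasure_density) auto

lemma emeasure_mu_lam_interval_bounds:
  assumes "0 < lam" "0 \<le> a" "a \<le> b"
  shows "emeasure (mu_lam lam) {a<..<b} \<le> ennreal ((b - a) * b powr (2 * lam))"
    and "ennreal ((b - a) * a powr (2 * lam)) \<le> emeasure (mu_lam lam) {a<..<b}"
proof -
  have *: "(\<integral>\<^sup>+x. ennreal k * indicator {a<..<b} x \<partial>lborel) = ennreal ((b - a) * k)" if "0 \<le> k" for k
    using assms that by (simp add: nn_integral_cmult ennreal_mult mult.commute)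
  have "emeasure (mu_lam lam) {a<..<b} \<le> (\<integral>\<^sup>+x. ennreal (b powr (2*lam)) * indicator {a<..<b} x \<partial>lborel)"
    unfolding emeasure_mu_lam[of "{a<..<b}", simplified]
    by (intro nn_integral_mono) (use assms in \<open>auto split: split_indicator intro!: ennreal_leI powr_mono2\<close>)
  then show "emeasure (mu_lam lam) {a<..<b} \<le> ennreal ((b - a) * b powr (2 * lam))" by (simp add: *)
  have "(\<integral>\<^sup>+x. ennreal (a powr (2*lam)) * indicator {a<..<b} x \<partial>lborel) \<le> emeasure (mu_lam lam) {a<..<b}"
    unfolding emeasure_mu_lam[of "{a<..<b}", simplified]
    by (intro nn_integral_mono) (use assms in \<open>auto split: split_indicator intro!: ennreal_leI powr_mono2\<close>)
  then show "ennreal ((b - a) * a powr (2 * lam)) \<le> emeasure (mu_lam lam) {a<..<b}" by (simp add: *)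
qed

lemma laminar_dyadic_cubes:
  assumes "dyadic_system \<delta> a1 A1 D"
  shows "laminar (dyadic_cubes D)"
proof -
  have nest: "P \<subseteq> Q \<or> P \<inter> Q = {}" if "k \<le> l" "Q \<in> D k" "P \<in> D l" for k l P Q
    using assms that unfolding dyadic_system_def by meson
  show ?thesis
    unfolding laminar_def dyadic_cubes_def
  proof safe
    fix P Q k l x y z assume "P \<in> D k" "Q \<in> D l" "x \<in> P" "x \<notin> Q" "y \<in> Q" "y \<notin> P" "z \<in> P" "z \<in> Q"
    then show "z \<in> {}" using nest[of k l P Q] nest[of l k Q P] by (cases "k \<le> l") auto
  qed
qed

lemma countable_dyadic_cubes:
  assumes "dyadic_system \<delta> a1 A1 D"
  shows "countable (dyadic_cubes D)"
  using assms unfolding dyadic_system_def dyadic_cubes_def by auto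

text \<open>The weight condition speaks of intervals, while cubes are general Borel sets; this
  supplies an enclosing interval of comparable \<open>mu_lam\<close>-measure. The scale factor of
  the generation cancels in the ratio of outer to inner radius, so the constant is the same for all
  cubes.\<close>

lemma dyadic_cube_enclosing_interval:
  assumes lam: "0 < lam" and D: "dyadic_system \<delta> a1 A1 D" and Q: "Q \<in> dyadic_cubes D"
  obtains a b where "0 \<le> a" "a < b" "Q \<in> sets borel" "Q \<subseteq> {a<..<b}" "0 < measure (mu_lam lam) Q"
    "measure (mu_lam lam) {a<..<b} \<le> 4 * (A1 / a1) * (2 * A1 / a1) powr (2 * lam) * measure (mu_lam lam) Q"
proof -
  have d: "0 < \<delta>" "0 < a1" "a1 \<le> A1" using D unfolding dyadic_system_def by auto
  obtain k x where Qs: "Q \<in> sets borel" and x: "x > 0" "rball x (a1 * \<delta> powr k) \<subseteq> Q" "Q \<subseteq> rball x (A1 * \<delta> powr k)"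
    using D Q unfolding dyadic_system_def dyadic_cubes_def by (auto, metis)
  define r R where "r = a1 * \<delta> powr k" and "R = A1 * \<delta> powr k"
  have r: "0 < r" "r \<le> R" and quot: "R / r = A1 / a1" using d by (auto simp: r_def R_def)
  \<comment> \<open>The outer ball lives in the half-line, hence the truncation at 0.\<close>
  define a b where "a = max 0 (x - R)" and "b = x + R"
  have ab: "0 \<le> a" "a < b" using x r by (auto simp: a_def b_def)
  have sub: "Q \<subseteq> {a<..<b}" using x(3) unfolding a_def b_def R_def rball_def by (force simp: abs_less_iff)
  \<comment> \<open>The right part of the inner ball stays in the half-line however close
    \<open>x\<close> is to 0, and the density there is at least its value at
    \<open>x + r/2\<close>.\<close>
  let ?J = "{x + r/2<..<x + r}"
  have J: "?J \<subseteq> Q" using x(1,2) r unfolding rball_def r_def[symmetric] by (force simp: abs_less_iff)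
  have fin: "emeasure (mu_lam lam) {a<..<b} < \<infinity>"
    using emeasure_mu_lam_interval_bounds(1)[OF lam, of a b] ab by (simp add: le_less_trans)
  have finQ: "emeasure (mu_lam lam) Q < \<infinity>"
    using emeasure_mono[OF sub, of "mu_lam lam"] fin by (simp add: le_less_trans)
  have mB: "measure (mu_lam lam) {a<..<b} \<le> (2*R) * (x+R) powr (2*lam)"
  proof -
    have "measure (mu_lam lam) {a<..<b} \<le> (b - a) * b powr (2*lam)"
      using emeasure_mu_lam_interval_bounds(1)[OF lam, of a b] ab
      by (simp add: measure_def enn2real_leI)
    also have "\<dots> \<le> (2*R) * (x+R) powr (2*lam)"
      unfolding b_def a_def by (intro mult_right_mono) auto
    finally show ?thesis .
  qed
  have mQ: "(r/2) * (x + r/2) powr (2*lam) \<le> measure (mu_lam lam) Q"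
  proof -
    have "ennreal ((r/2) * (x + r/2) powr (2*lam)) \<le> emeasure (mu_lam lam) ?J"
      using emeasure_mu_lam_interval_bounds(2)[OF lam, of "x + r/2" "x + r"] x r by simp
    also have "\<dots> \<le> emeasure (mu_lam lam) Q" using J Qs by (intro emeasure_mono) auto
    also have "\<dots> = ennreal (measure (mu_lam lam) Q)"
      using finQ by (intro emeasure_eq_ennreal_measure) auto
    finally show ?thesis by (subst (asm) ennreal_le_iff) auto
  qed
  have pos: "0 < (r/2) * (x + r/2) powr (2*lam)" using r x by simp
  \<comment> \<open>Compares the largest density on the interval with the smallest on
    \<open>?J\<close>; the length ratio 2R to r/2 accounts for the separate factor 4 R/r.\<close>
  have c: "x + R \<le> (2 * R / r) * (x + r/2)"
  proof -
    have "1 \<le> 2 * R / r" using r by (simp add: field_simps)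
    then have "1 * x \<le> (2 * R / r) * x" using x(1) by (intro mult_right_mono) auto
    moreover have "(2 * R / r) * (r/2) = R" using r by simp
    ultimately show ?thesis by (simp add: distrib_left del: times_divide_eq_left)
  qed
  have "(2*R) * (x+R) powr (2*lam) \<le> (2*R) * ((2 * R / r) * (x + r/2)) powr (2*lam)"
    using c r x lam by (intro mult_left_mono powr_mono2) auto
  also have "\<dots> = 4 * (R / r) * (2 * (R / r)) powr (2*lam) * ((r/2) * (x + r/2) powr (2*lam))"
    unfolding powr_mult[of "2 * R / r"] using r by simp
  also have "\<dots> \<le> 4 * (R / r) * (2 * (R / r)) powr (2*lam) * measure (mu_lam lam) Q"
    using r by (intro mult_left_mono mQ) auto
  finally have "measure (mu_lam lam) {a<..<b} \<le> 4 * (A1/a1) * (2 * A1/a1) powr (2*lam) * measure (mu_lam lam) Q"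
    using mB unfolding quot by simp
  then show thesis using that[of a b] ab Qs sub less_le_trans[OF pos mQ] by blast
qed

section \<open>Weights\<close>

text \<open>Weights are constrained on the positive half-line; the indicator discards their
  arbitrary values elsewhere.\<close>

definition weight_measure :: "(real \<Rightarrow> real) \<Rightarrow> real measure" where
  "weight_measure u = density lborel (\<lambda>x. ennreal (indicator {0<..} x * u x))"

definition dual_weight :: "real \<Rightarrow> real \<Rightarrow> (real \<Rightarrow> real) \<Rightarrow> real \<Rightarrow> real" where
  "dual_weight lam p w t = t powr (2 * lam * (p / (p - 1))) * w t powr (- 1 / (p - 1))"

lemma mu_lam_eq_weight_measure: "mu_lam lam = weight_measure (\<lambda>x. x powr (2 * lam))"
  by (simp add: mu_lam_def weight_measure_def)

lemma sets_weight_measure [measurable_cong, simp]: "sets (weight_measure u) = sets borel"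
  by (simp add: weight_measure_def)

lemma nn_integral_weight_measure:
  assumes [measurable]: "u \<in> borel_measurable borel" "k \<in> borel_measurable borel"
  shows "(\<integral>\<^sup>+x. k x \<partial>weight_measure u) = (\<integral>\<^sup>+x. ennreal (indicator {0<..} x * u x) * k x \<partial>lborel)"
  unfolding weight_measure_def by (rule nn_integral_density) auto

lemma emeasure_weight_measure_interval:
  assumes u[measurable]: "u \<in> borel_measurable borel" and u0: "\<And>x. 0 < x \<Longrightarrow> 0 \<le> u x"
    and "set_integrable lborel {a<..<b} u" and "0 \<le> a"
  shows "emeasure (weight_measure u) {a<..<b} = ennreal (LBINT t:{a<..<b}. u t)"
proof -
  have "emeasure (weight_measure u) {a<..<b}
      = (\<integral>\<^sup>+x. ennreal (indicator {0<..} x * u x) * indicator {a<..<b} x \<partial>lborel)"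
    unfolding weight_measure_def by (rule emeasure_density) auto
  also have "\<dots> = (\<integral>\<^sup>+x. ennreal (indicator {a<..<b} x *\<^sub>R u x) \<partial>lborel)"
    using assms by (intro nn_integral_cong) (auto split: split_indicator)
  also have "\<dots> = ennreal (LBINT t:{a<..<b}. u t)"
    unfolding set_lebesgue_integral_def
    using assms by (intro nn_integral_eq_integral) (auto simp: set_integrable_def split: split_indicator)
  finally show ?thesis .
qed

lemma Ap_const_nonneg:
  assumes "Ap_weight lam p w"
  shows "0 \<le> Ap_const lam p w"
proof -
  have w: "\<And>x. 0 < x \<Longrightarrow> 0 \<le> w x" and bdd: "bdd_above {Ap_expr lam p w a b | a b. 0 \<le> a \<and> a < b}"
    using assms unfolding Ap_weight_def by auto
  have "0 \<le> (LBINT t:{0<..<1}. w t)"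
    unfolding set_lebesgue_integral_def using w by (intro integral_nonneg_AE) (auto split: split_indicator)
  \<comment> \<open>One nonnegative member of the family suffices for the supremum; (0,1) is an
    arbitrary choice.\<close>
  then have "0 \<le> Ap_expr lam p w 0 1" unfolding Ap_expr_def Let_def by simp
  also have "\<dots> \<le> Ap_const lam p w"
    unfolding Ap_const_def
    by (rule cSUP_upper2[where x="(0,1)"]) (use bdd in \<open>auto simp: bdd_above_def\<close>)
  finally show ?thesis .
qed

lemma Ap_weight_interval:
  assumes p: "1 < p" and w: "Ap_weight lam p w" and ab: "0 \<le> a" "a < b"
    and m: "0 < measure (mu_lam lam) {a<..<b}"
  shows "emeasure (weight_measure w) {a<..<b} < \<infinity>"
    and "emeasure (weight_measure (dual_weight lam p w)) {a<..<b} < \<infinity>"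
    and "measure (weight_measure w) {a<..<b} * measure (weight_measure (dual_weight lam p w)) {a<..<b} powr (p - 1)
      \<le> Ap_const lam p w * measure (mu_lam lam) {a<..<b} powr p"
proof -
  have [measurable]: "w \<in> borel_measurable borel"
    and w0: "\<And>x. 0 < x \<Longrightarrow> 0 \<le> w x" and bdd: "bdd_above {Ap_expr lam p w a b | a b. 0 \<le> a \<and> a < b}"
    and int: "set_integrable lborel {a<..<b} w" "set_integrable lborel {a<..<b} (dual_weight lam p w)"
    using w ab unfolding Ap_weight_def dual_weight_def[abs_def] by auto
  have [measurable]: "dual_weight lam p w \<in> borel_measurable borel"
    unfolding dual_weight_def[abs_def] by measurable
  have V: "emeasure (weight_measure w) {a<..<b} = ennreal (LBINT t:{a<..<b}. w t)"
    by (rule emeasure_weight_measure_interval) (use w0 int ab in auto)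
  have G: "emeasure (weight_measure (dual_weight lam p w)) {a<..<b} = ennreal (LBINT t:{a<..<b}. dual_weight lam p w t)"
    by (rule emeasure_weight_measure_interval) (use int ab in \<open>auto simp: dual_weight_def\<close>)
  show "emeasure (weight_measure w) {a<..<b} < \<infinity>" "emeasure (weight_measure (dual_weight lam p w)) {a<..<b} < \<infinity>"
    by (simp_all add: V G)
  have "0 \<le> (LBINT t:{a<..<b}. w t)" "0 \<le> (LBINT t:{a<..<b}. dual_weight lam p w t)"
    unfolding set_lebesgue_integral_def dual_weight_def using w0 ab
    by (auto intro!: integral_nonneg_AE split: split_indicator)
  then have V': "measure (weight_measure w) {a<..<b} = (LBINT t:{a<..<b}. w t)"
    and G': "measure (weight_measure (dual_weight lam p w)) {a<..<b} = (LBINT t:{a<..<b}. dual_weight lam p w t)"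
    using V G by (simp_all add: measure_def)
  let ?m = "measure (mu_lam lam) {a<..<b}"
  have "Ap_expr lam p w a b \<le> Ap_const lam p w"
    unfolding Ap_const_def
    by (rule cSUP_upper2[where x="(a,b)"]) (use bdd ab in \<open>auto simp: bdd_above_def\<close>)
  then have "measure (weight_measure w) {a<..<b} / ?m * (measure (weight_measure (dual_weight lam p w)) {a<..<b} / ?m) powr (p-1)
      \<le> Ap_const lam p w"
    unfolding V' G' by (simp add: Ap_expr_def Let_def dual_weight_def[abs_def])
  then have "measure (weight_measure w) {a<..<b} * measure (weight_measure (dual_weight lam p w)) {a<..<b} powr (p-1)
      / (?m * ?m powr (p-1)) \<le> Ap_const lam p w"
    by (simp add: powr_divide)
  moreover have "?m * ?m powr (p-1) = ?m powr p" using powr_mult_base[of ?m "p-1"] m by simp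
  ultimately show "measure (weight_measure w) {a<..<b} * measure (weight_measure (dual_weight lam p w)) {a<..<b} powr (p - 1)
      \<le> Ap_const lam p w * ?m powr p"
    using m by (simp add: pos_divide_le_eq)
qed

text \<open>The pointwise algebra linking the measures: the second identity is the factorisation
  that Hoelder uses to compare \<open>mu_lam\<close> with the two weights, and the third shows that
  passing from f to f x^(2 lam) / sigma preserves the weighted norm, with sigma the dual
  weight.\<close>

lemma dual_weight_identity:
  assumes p: "1 < p" and x: "0 < x" "0 < w x"
  shows "0 < dual_weight lam p w x"
    and "x powr (2 * lam) = w x powr (1/p) * dual_weight lam p w x powr (1/(p/(p-1)))"
    and "(y * x powr (2 * lam) / dual_weight lam p w x) powr p * dual_weight lam p w x = y powr p * w x"
proof -
  let ?s = "dual_weight lam p w x"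
  show s: "0 < ?s" using x by (simp add: dual_weight_def)
  have "?s powr (1/(p/(p-1))) = x powr (2*lam) * w x powr (-(1/p))"
    using p by (simp add: dual_weight_def powr_mult powr_powr)
  then show id: "x powr (2 * lam) = w x powr (1/p) * ?s powr (1/(p/(p-1)))"
    using x by (simp add: powr_minus)
  have "(x powr (2*lam)) powr p = w x * ?s powr (p - 1)"
    unfolding id using p x by (simp add: powr_mult powr_powr)
  then have "(y * x powr (2 * lam) / ?s) powr p * ?s = y powr p * w x * (?s powr (p-1) * ?s / ?s powr p)"
    by (simp add: powr_mult powr_divide)
  also have "?s powr (p-1) * ?s = ?s powr p" using s powr_mult_base[of ?s "p-1"] by (simp add: mult.commute)
  finally show "(y * x powr (2 * lam) / ?s) powr p * ?s = y powr p * w x" using s by simp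
qed

section \<open>Averages over cubes measured by the weight and its dual\<close>

lemma abs_avg_le:
  assumes [measurable]: "f \<in> borel_measurable borel" "Q \<in> sets borel"
  shows "\<bar>avg lam Q f\<bar> \<le> enn2real (\<integral>\<^sup>+x\<in>Q. ennreal \<bar>f x\<bar> \<partial>mu_lam lam) / measure (mu_lam lam) Q"
proof -
  have "\<bar>set_lebesgue_integral (mu_lam lam) Q f\<bar> \<le> (\<integral>x. norm (indicator Q x *\<^sub>R f x) \<partial>mu_lam lam)"
    unfolding set_lebesgue_integral_def
    using integral_norm_bound[of "mu_lam lam" "\<lambda>x. indicator Q x *\<^sub>R f x"] by simp
  \<comment> \<open>This also holds without integrability: both sides are then 0 by
    convention.\<close>
  also have "\<dots> = enn2real (\<integral>\<^sup>+x. ennreal (norm (indicator Q x *\<^sub>R f x)) \<partial>mu_lam lam)"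
    by (rule integral_eq_nn_integral) auto
  also have "(\<integral>\<^sup>+x. ennreal (norm (indicator Q x *\<^sub>R f x)) \<partial>mu_lam lam) = (\<integral>\<^sup>+x\<in>Q. ennreal \<bar>f x\<bar> \<partial>mu_lam lam)"
    by (intro nn_integral_cong) (auto split: split_indicator)
  finally show ?thesis by (simp add: avg_def divide_right_mono)
qed


lemma measure_mu_lam_le_weights:
  assumes p: "1 < p" and w: "Ap_weight lam p w" and E[measurable]: "E \<in> sets borel"
    and fin: "emeasure (weight_measure w) E < \<infinity>" "emeasure (weight_measure (dual_weight lam p w)) E < \<infinity>"
  shows "measure (mu_lam lam) E
    \<le> measure (weight_measure w) E powr (1/p) * measure (weight_measure (dual_weight lam p w)) E powr (1/(p/(p-1)))"
proof -
  let ?q = "p/(p-1)" and ?s = "dual_weight lam p w"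
  have q: "1 < ?q" "1/p + 1/?q = 1" using p by (simp_all add: field_simps)
  have [measurable]: "w \<in> borel_measurable borel"
    and w0: "\<And>x. 0 < x \<Longrightarrow> 0 \<le> w x" and wpos: "AE x in lborel. 0 < x \<longrightarrow> 0 < w x"
    using w unfolding Ap_weight_def by auto
  have [measurable]: "?s \<in> borel_measurable borel" unfolding dual_weight_def[abs_def] by measurable
  have s0: "0 \<le> ?s x" for x by (simp add: dual_weight_def)
  have pw: "(\<integral>\<^sup>+x. ennreal (((indicator {0<..} x * u x) powr (1/r) * indicator E x) powr r) \<partial>lborel)
      \<le> ennreal (measure (weight_measure u) E)"
    if [measurable]: "u \<in> borel_measurable borel" and u0: "\<And>x. 0 < x \<Longrightarrow> 0 \<le> u x" and r: "1 < r"
      and fin: "emeasure (weight_measure u) E < \<infinity>" for u :: "real \<Rightarrow> real" and r :: real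
  proof -
    have "(\<integral>\<^sup>+x. ennreal (((indicator {0<..} x * u x) powr (1/r) * indicator E x) powr r) \<partial>lborel)
        = (\<integral>\<^sup>+x. ennreal (indicator {0<..} x * u x) * indicator E x \<partial>lborel)"
      using r u0 by (intro nn_integral_cong) (auto simp: powr_powr split: split_indicator)
    also have "\<dots> = emeasure (weight_measure u) E"
      unfolding weight_measure_def by (rule emeasure_density[symmetric]) auto
    also have "\<dots> = ennreal (measure (weight_measure u) E)"
      using fin by (intro emeasure_eq_ennreal_measure) auto
    finally show ?thesis by simp
  qed
  have "emeasure (mu_lam lam) E = (\<integral>\<^sup>+x\<in>E. ennreal (indicator {0<..} x * x powr (2 * lam)) \<partial>lborel)"
    by (rule emeasure_mu_lam) simp
  also have "\<dots> = (\<integral>\<^sup>+x. ennreal (((indicator {0<..} x * w x) powr (1/p) * indicator E x) *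
      ((indicator {0<..} x * ?s x) powr (1/?q) * indicator E x)) \<partial>lborel)"
    \<comment> \<open>The factorisation requires \<open>w x\<close> > 0, which is known almost
      everywhere.\<close>
    using wpos
  proof (intro nn_integral_cong_AE, eventually_elim)
    case (elim x)
    show ?case
    proof (cases "0 < x")
      case True
      then show ?thesis using dual_weight_identity(2)[OF p, of x w lam] elim by (simp split: split_indicator)
    qed simp
  qed
  also have "\<dots> \<le> ennreal (measure (weight_measure w) E powr (1/p) * measure (weight_measure ?s) E powr (1/?q))"
    by (rule nn_integral_Holder[OF p q _ _ _ _ _ _ pw pw]) (use w0 s0 p q fin in auto)
  finally show ?thesis by (simp add: measure_def enn2real_leI)
qed

text \<open>Masses of the cube are enlarged to those of the enclosing interval, where the weight
  condition applies; returning to the cube's own \<open>mu_lam\<close>-measure costs the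
  comparability constant to the power p.\<close>

lemma dyadic_cube_Ap_bound:
  assumes lam: "0 < lam" and p: "1 < p" and D: "dyadic_system \<delta> a1 A1 D" and Q: "Q \<in> dyadic_cubes D"
    and w: "Ap_weight lam p w"
  shows "Q \<in> sets borel" "0 < measure (mu_lam lam) Q"
    and "emeasure (weight_measure w) Q < \<infinity>"
    and "emeasure (weight_measure (dual_weight lam p w)) Q < \<infinity>"
    and "measure (weight_measure w) Q * measure (weight_measure (dual_weight lam p w)) Q powr (p - 1)
      \<le> Ap_const lam p w * (4 * (A1 / a1) * (2 * A1 / a1) powr (2 * lam)) powr p * measure (mu_lam lam) Q powr p"
proof -
  let ?D = "4 * (A1 / a1) * (2 * A1 / a1) powr (2 * lam)"
  let ?V = "weight_measure w" and ?G = "weight_measure (dual_weight lam p w)"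
  obtain a b where ab: "0 \<le> a" "a < b" and Qs: "Q \<in> sets borel" and sub: "Q \<subseteq> {a<..<b}"
    and mQ: "0 < measure (mu_lam lam) Q"
    and dbl: "measure (mu_lam lam) {a<..<b} \<le> ?D * measure (mu_lam lam) Q"
    by (rule dyadic_cube_enclosing_interval[OF lam D Q])
  show "Q \<in> sets borel" "0 < measure (mu_lam lam) Q" by fact+
  have "emeasure (mu_lam lam) {a<..<b} < \<infinity>"
    using emeasure_mu_lam_interval_bounds(1)[OF lam, of a b] ab by (simp add: le_less_trans)
  then have "measure (mu_lam lam) Q \<le> measure (mu_lam lam) {a<..<b}"
    using sub Qs by (intro measure_mono_fmeasurable) (auto simp: fmeasurable_def)
  then have mB: "0 < measure (mu_lam lam) {a<..<b}" using mQ by simp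
  note I = Ap_weight_interval[OF p w ab mB]
  show fin: "emeasure ?V Q < \<infinity>" "emeasure ?G Q < \<infinity>"
    using emeasure_mono[OF sub, of ?V] emeasure_mono[OF sub, of ?G] I(1,2) by (simp_all add: le_less_trans)
  have "measure ?V Q * measure ?G Q powr (p - 1) \<le> measure ?V {a<..<b} * measure ?G {a<..<b} powr (p - 1)"
    using sub Qs I(1,2) p
    by (intro mult_mono powr_mono2 measure_mono_fmeasurable) (auto simp: fmeasurable_def)
  also have "\<dots> \<le> Ap_const lam p w * measure (mu_lam lam) {a<..<b} powr p" by (rule I(3))
  also have "\<dots> \<le> Ap_const lam p w * (?D * measure (mu_lam lam) Q) powr p"
    using dbl p Ap_const_nonneg[OF w] by (intro mult_left_mono powr_mono2) auto
  also have "\<dots> = Ap_const lam p w * ?D powr p * measure (mu_lam lam) Q powr p"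
    by (subst powr_mult[of ?D]) (simp only: mult.assoc)
  finally show "measure ?V Q * measure ?G Q powr (p - 1) \<le> Ap_const lam p w * ?D powr p * measure (mu_lam lam) Q powr p" .
qed

lemma finite_sparse_averages_bound:
  fixes f :: "real \<Rightarrow> real"
  assumes lam: "0 < lam" and p: "1 < p" and L: "0 < \<Lambda>" and D: "dyadic_system \<delta> a1 A1 D"
    and S: "finite S" "S \<subseteq> dyadic_cubes D" and sp: "sparse lam \<Lambda> N S" and w: "Ap_weight lam p w"
    and [measurable]: "f \<in> borel_measurable borel" and f: "Lp_w_pow p w f < \<infinity>"
  shows "(\<integral>\<^sup>+x. ennreal (indicator {0<..} x * w x *
      (\<Sum>Q\<in>S. enn2real (\<integral>\<^sup>+x\<in>Q. ennreal \<bar>f x\<bar> \<partial>mu_lam lam) / measure (mu_lam lam) Q * indicator Q x) powr p) \<partial>lborel)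
    \<le> ennreal (((\<Lambda> powr (1 - p) + \<Lambda> powr (1 - p/(p-1))) * (real N * p * (p/(p-1))) *
        (Ap_const lam p w * (4 * (A1 / a1) * (2 * A1 / a1) powr (2 * lam)) powr p) powr (max 1 (1/(p-1)))) powr p
        * enn2real (Lp_w_pow p w f))"
proof -
  let ?q = "p/(p-1)"
  define s where "s = dual_weight lam p w"
  define V where "V = weight_measure w"
  define G where "G = weight_measure s"
  define K where "K = Ap_const lam p w * (4 * (A1 / a1) * (2 * A1 / a1) powr (2 * lam)) powr p"
  define m where "m = measure (mu_lam lam)"
  \<comment> \<open>Chosen so that \<open>h\<close> times the dual weight is |f| times the density
    of \<open>mu_lam\<close>: integrals over cubes agree, and the norm of \<open>h\<close> under
    \<open>G\<close> is that of \<open>f\<close> under \<open>w\<close>.\<close>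
  define h where "h x = \<bar>f x\<bar> * x powr (2 * lam) / s x" for x
  have q: "1 < ?q" "1/p + 1/?q = 1" using p by (simp_all add: field_simps)
  have [measurable]: "w \<in> borel_measurable borel"
    and w0: "\<And>x. 0 < x \<Longrightarrow> 0 \<le> w x" and wpos: "AE x in lborel. 0 < x \<longrightarrow> 0 < w x"
    using w unfolding Ap_weight_def by auto
  have [measurable]: "s \<in> borel_measurable borel" unfolding s_def dual_weight_def[abs_def] by measurable
  have s0: "0 \<le> s x" for x by (simp add: s_def dual_weight_def)
  have [measurable]: "h \<in> borel_measurable borel" unfolding h_def[abs_def] by measurable
  have h0: "0 \<le> h x" for x using s0 by (simp add: h_def)
  have cube: "Q \<in> sets borel" "0 < m Q" "emeasure V Q < \<infinity>" "emeasure G Q < \<infinity>"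
    "measure V Q * measure G Q powr (p - 1) \<le> K * m Q powr p" if "Q \<in> S" for Q
    using dyadic_cube_Ap_bound[OF lam p D _ w, of Q] that S unfolding V_def G_def s_def K_def m_def by auto
  obtain E where E: "\<And>Q. Q \<in> S \<Longrightarrow> E Q \<subseteq> Q" "\<And>Q. Q \<in> S \<Longrightarrow> E Q \<in> sets borel"
      "\<And>Q. Q \<in> S \<Longrightarrow> \<Lambda> * m Q \<le> m (E Q)" and N: "\<And>x. card {Q\<in>S. x \<in> E Q} \<le> N"
    using sp unfolding sparse_def m_def by auto
  have mE: "m (E Q) \<le> measure V (E Q) powr (1/p) * measure G (E Q) powr (1/?q)" if "Q \<in> S" for Q
  proof -
    have "emeasure V (E Q) < \<infinity>" "emeasure G (E Q) < \<infinity>"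
      using emeasure_mono[OF E(1)[OF that], of V] emeasure_mono[OF E(1)[OF that], of G] cube[OF that]
      by (simp_all add: V_def G_def le_less_trans)
    then show ?thesis
      using measure_mu_lam_le_weights[OF p w E(2)[OF that]] by (simp add: V_def G_def s_def m_def)
  qed
  have "(\<integral>\<^sup>+x. ennreal (h x powr p) \<partial>G) = (\<integral>\<^sup>+x. ennreal (indicator {0<..} x * s x) * ennreal (h x powr p) \<partial>lborel)"
    unfolding G_def by (rule nn_integral_weight_measure) measurable
  also have "\<dots> = Lp_w_pow p w f"
    unfolding Lp_w_pow_def using wpos
  proof (intro nn_integral_cong_AE, eventually_elim)
    case (elim x)
    show ?case
    proof (cases "0 < x")
      case True
      then have "h x powr p * s x = \<bar>f x\<bar> powr p * w x"
        using dual_weight_identity(3)[OF p True, of w "\<bar>f x\<bar>" lam] elim by (simp add: h_def s_def)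
      then show ?thesis using True s0 by (simp add: mult.commute flip: ennreal_mult)
    qed simp
  qed
  finally have hA: "(\<integral>\<^sup>+x. ennreal (h x powr p) \<partial>G) \<le> ennreal (enn2real (Lp_w_pow p w f))" using f by simp
  have hQ: "(\<integral>\<^sup>+x\<in>Q. ennreal (h x) \<partial>G) = (\<integral>\<^sup>+x\<in>Q. ennreal \<bar>f x\<bar> \<partial>mu_lam lam)" if "Q \<in> S" for Q
  proof -
    have [measurable]: "Q \<in> sets borel" using cube that by blast
    have "(\<integral>\<^sup>+x\<in>Q. ennreal (h x) \<partial>G) = (\<integral>\<^sup>+x. ennreal (indicator {0<..} x * s x) * (ennreal (h x) * indicator Q x) \<partial>lborel)"
      unfolding G_def by (rule nn_integral_weight_measure) measurable
    also have "\<dots> = (\<integral>\<^sup>+x. ennreal (indicator {0<..} x * x powr (2*lam)) * (ennreal \<bar>f x\<bar> * indicator Q x) \<partial>lborel)"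
      using wpos
    proof (intro nn_integral_cong_AE, eventually_elim)
      case (elim x)
      show ?case
      proof (cases "0 < x")
        case True
        then have "0 < s x" using dual_weight_identity(1)[OF p True, of w lam] elim by (simp add: s_def)
        then have "s x * h x = x powr (2*lam) * \<bar>f x\<bar>" by (simp add: h_def)
        then show ?thesis using True s0 h0 by (auto simp flip: ennreal_mult split: split_indicator)
      qed simp
    qed
    also have "\<dots> = (\<integral>\<^sup>+x\<in>Q. ennreal \<bar>f x\<bar> \<partial>mu_lam lam)"
      unfolding mu_lam_eq_weight_measure by (rule nn_integral_weight_measure[symmetric]) measurable
    finally show ?thesis .
  qed
  let ?F = "\<lambda>x. \<Sum>Q\<in>S. enn2real (\<integral>\<^sup>+x\<in>Q. ennreal \<bar>f x\<bar> \<partial>mu_lam lam) / m Q * indicator Q x"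
  have [measurable]: "?F \<in> borel_measurable borel"
    using cube(1) by (intro borel_measurable_sum borel_measurable_times borel_measurable_indicator) auto
  have "(\<integral>\<^sup>+x. ennreal ((\<Sum>Q\<in>S. enn2real (\<integral>\<^sup>+x\<in>Q. ennreal (h x) \<partial>G) / m Q * indicator Q x) powr p) \<partial>V)
      \<le> ennreal (((\<Lambda> powr (1 - p) + \<Lambda> powr (1 - ?q)) * (real N * p * ?q) * K powr (max 1 (1/(p-1)))) powr p
        * enn2real (Lp_w_pow p w f))"
  proof (rule finite_sparse_operator_bound[OF p q S(1), where E = E and e = "\<lambda>Q. m (E Q)"])
    show "laminar S" by (rule laminar_subset[OF laminar_dyadic_cubes[OF D] S(2)])
    show "0 \<le> K" using Ap_const_nonneg[OF w] by (simp add: K_def)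
    show "h \<in> borel_measurable G" by (simp add: G_def)
  qed (use cube E N mE h0 hA L in \<open>auto simp: V_def G_def\<close>)
  also have "(\<lambda>x. \<Sum>Q\<in>S. enn2real (\<integral>\<^sup>+x\<in>Q. ennreal (h x) \<partial>G) / m Q * indicator Q x) = ?F"
    by (intro ext sum.cong refl) (simp add: hQ)
  also have "(\<integral>\<^sup>+x. ennreal (?F x powr p) \<partial>V) = (\<integral>\<^sup>+x. ennreal (indicator {0<..} x * w x) * ennreal (?F x powr p) \<partial>lborel)"
    unfolding V_def by (rule nn_integral_weight_measure) measurable
  also have "\<dots> = (\<integral>\<^sup>+x. ennreal (indicator {0<..} x * w x * ?F x powr p) \<partial>lborel)"
    using w0 by (intro nn_integral_cong ennreal_mult[symmetric]) (auto split: split_indicator)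
  finally show ?thesis unfolding K_def m_def .
qed

section \<open>The full operator with a uniform constant\<close>

theorem theorem1p4:
  fixes lam p \<Lambda> \<delta> a1 A1 :: real and N :: nat and D :: "int \<Rightarrow> real set set"
  assumes "0 < lam" and "1 < p" and "0 < \<Lambda>" and "\<Lambda> < 1"
    and "dyadic_system \<delta> a1 A1 D" and "1 \<le> N"
  shows "\<exists>C>0. \<forall>S w f.
           S \<subseteq> dyadic_cubes D \<longrightarrow> sparse lam \<Lambda> N S \<longrightarrow> Ap_weight lam p w \<longrightarrow>
           f \<in> borel_measurable lborel \<longrightarrow> Lp_w_pow p w f < \<infinity> \<longrightarrow>
           (AE x in lborel. 0 < x \<longrightarrow>
               (\<lambda>Q. \<bar>avg lam Q f * indicator Q x\<bar>) summable_on S) \<and>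
           Lp_w_pow p w (sparse_op lam S f)
             \<le> ennreal ((C * Ap_const lam p w powr (max 1 (1 / (p - 1)))) powr p) * Lp_w_pow p w f"
proof -
  define \<kappa> where "\<kappa> = max 1 (1 / (p - 1))"
  define d where "d = 4 * (A1 / a1) * (2 * A1 / a1) powr (2 * lam)"
  \<comment> \<open>The finite estimate contains the weight constant times \<open>d powr p\<close>,
    all raised to \<open>\<kappa>\<close>; splitting this power separates the geometric factor from
    the weight.\<close>
  define C where "C = (\<Lambda> powr (1 - p) + \<Lambda> powr (1 - p/(p-1))) * (real N * p * (p/(p-1))) * (d powr p) powr \<kappa>"
  have "0 < a1" "a1 \<le> A1" using assms(5) unfolding dyadic_system_def by auto
  then have "0 < d" by (simp add: d_def)
  then have C: "0 < C" unfolding C_def using assms by (intro mult_pos_pos add_pos_pos) auto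
  show ?thesis
  proof (intro exI[of _ C] conjI C allI impI)
    fix S w f
    assume S: "S \<subseteq> dyadic_cubes D" and sp: "sparse lam \<Lambda> N S" and w: "Ap_weight lam p w"
      and "f \<in> borel_measurable lborel" and f: "Lp_w_pow p w f < \<infinity>"
    then have fm[measurable]: "f \<in> borel_measurable borel" by simp
    have [measurable]: "w \<in> borel_measurable borel"
      and w0: "\<And>x. 0 < x \<Longrightarrow> 0 \<le> w x" and wpos: "AE x in lborel. 0 < x \<longrightarrow> 0 < w x"
      using w unfolding Ap_weight_def by auto
    define c where "c Q = enn2real (\<integral>\<^sup>+x\<in>Q. ennreal \<bar>f x\<bar> \<partial>mu_lam lam) / measure (mu_lam lam) Q" for Q
    define W where "W x = indicator {0<..} x * w x" for x
    define R where "R = (C * Ap_const lam p w powr \<kappa>) powr p * enn2real (Lp_w_pow p w f)"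
    have S_sets: "S \<subseteq> sets lborel" using S dyadic_cube_Ap_bound(1)[OF assms(1,2,5) _ w] by auto
    have R: "ennreal R = ennreal ((C * Ap_const lam p w powr \<kappa>) powr p) * Lp_w_pow p w f"
      using f by (simp add: R_def ennreal_mult)
    have bound: "(\<integral>\<^sup>+x. ennreal (W x * (\<Sum>Q\<in>T. c Q * indicator Q x) powr p) \<partial>lborel) \<le> ennreal R"
      if T: "finite T" "T \<subseteq> S" for T
    proof -
      \<comment> \<open>A subfamily keeps the same sets \<open>E Q\<close>, so neither
        \<open>\<Lambda>\<close> nor \<open>N\<close> changes.\<close>
      have "sparse lam \<Lambda> N T"
      proof -
        obtain E where E: "\<forall>Q\<in>S. E Q \<subseteq> Q \<and> E Q \<in> sets lborel \<and> \<Lambda> * measure (mu_lam lam) Q \<le> measure (mu_lam lam) (E Q)"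
          "\<forall>x. finite {Q\<in>S. x \<in> E Q} \<and> card {Q\<in>S. x \<in> E Q} \<le> N"
          using sp unfolding sparse_def by blast
        have "card {Q\<in>T. x \<in> E Q} \<le> N" for x
        proof -
          have "card {Q\<in>T. x \<in> E Q} \<le> card {Q\<in>S. x \<in> E Q}" using E(2) T(2) by (intro card_mono) auto
          then show ?thesis using E(2) order_trans by blast
        qed
        then show ?thesis unfolding sparse_def using E(1) T by (intro exI[of _ E]) auto
      qed
      from finite_sparse_averages_bound[OF assms(1,2,3,5) T(1) _ this w fm f] T(2) S
      have "(\<integral>\<^sup>+x. ennreal (W x * (\<Sum>Q\<in>T. c Q * indicator Q x) powr p) \<partial>lborel)
        \<le> ennreal (((\<Lambda> powr (1 - p) + \<Lambda> powr (1 - p/(p-1))) * (real N * p * (p/(p-1))) *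
          (Ap_const lam p w * d powr p) powr \<kappa>) powr p * enn2real (Lp_w_pow p w f))"
        unfolding W_def c_def d_def \<kappa>_def by blast
      also have "(\<Lambda> powr (1 - p) + \<Lambda> powr (1 - p/(p-1))) * (real N * p * (p/(p-1))) *
          (Ap_const lam p w * d powr p) powr \<kappa> = C * Ap_const lam p w powr \<kappa>"
        unfolding C_def powr_mult by (simp only: mult_ac)
      finally show ?thesis unfolding R_def .
    qed
    have c0: "0 \<le> c Q" for Q by (simp add: c_def)
    have W0: "0 \<le> W x" for x using w0 by (simp add: W_def split: split_indicator)
    have Wm: "W \<in> borel_measurable lborel" unfolding W_def[abs_def] by measurable
    have Sc: "countable S" using countable_dyadic_cubes[OF assms(5)] S by (rule countable_subset[rotated])
    have lim: "AE x in lborel. 0 < W x \<longrightarrow> (\<lambda>Q. c Q * indicator Q x) summable_on S"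
      "(\<integral>\<^sup>+x. ennreal (W x * (\<Sum>\<^sub>\<infinity>Q\<in>S. c Q * indicator Q x) powr p) \<partial>lborel) \<le> ennreal R"
      using countable_sum_indicator_powr_bound[of p S lborel c W R, OF assms(2) Sc S_sets c0 Wm W0 bound] by blast+
    have avg_le: "\<bar>avg lam Q f * indicator Q x\<bar> \<le> c Q * indicator Q x" if "Q \<in> S" for Q x
      using abs_avg_le[OF fm, of Q lam] S_sets that by (auto simp: c_def split: split_indicator)
    \<comment> \<open>Domination by the averages of |f|, summable almost everywhere, gives absolute
      convergence, so \<open>sparse_op\<close> is a genuine sum there and not the default 0.\<close>
    have key: "AE x in lborel. 0 < x \<longrightarrow> (\<lambda>Q. \<bar>avg lam Q f * indicator Q x\<bar>) summable_on S \<and>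
        \<bar>sparse_op lam S f x\<bar> \<le> (\<Sum>\<^sub>\<infinity>Q\<in>S. c Q * indicator Q x)"
      using lim(1) wpos
    proof eventually_elim
      case (elim x)
      show ?case
      proof
        assume x: "0 < x"
        then have sm: "(\<lambda>Q. c Q * indicator Q x) summable_on S" using elim by (simp add: W_def)
        have sa: "(\<lambda>Q. \<bar>avg lam Q f * indicator Q x\<bar>) summable_on S"
          by (rule summable_on_comparison_test[OF sm avg_le]) auto
        have "\<bar>sparse_op lam S f x\<bar> \<le> (\<Sum>\<^sub>\<infinity>Q\<in>S. \<bar>avg lam Q f * indicator Q x\<bar>)"
          unfolding sparse_op_def using norm_infsum_bound[of "\<lambda>Q. avg lam Q f * indicator Q x" S] sa by simp
        also have "\<dots> \<le> (\<Sum>\<^sub>\<infinity>Q\<in>S. c Q * indicator Q x)"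
          by (rule infsum_mono[OF sa sm avg_le])
        finally show "(\<lambda>Q. \<bar>avg lam Q f * indicator Q x\<bar>) summable_on S \<and>
            \<bar>sparse_op lam S f x\<bar> \<le> (\<Sum>\<^sub>\<infinity>Q\<in>S. c Q * indicator Q x)" using sa by blast
      qed
    qed
    then show "AE x in lborel. 0 < x \<longrightarrow> (\<lambda>Q. \<bar>avg lam Q f * indicator Q x\<bar>) summable_on S"
      by eventually_elim blast
    have "Lp_w_pow p w (sparse_op lam S f)
        \<le> (\<integral>\<^sup>+x. ennreal (W x * (\<Sum>\<^sub>\<infinity>Q\<in>S. c Q * indicator Q x) powr p) \<partial>lborel)"
      unfolding Lp_w_pow_def using key
    proof (intro nn_integral_mono_AE, eventually_elim)
      case (elim x)
      show ?case
      proof (cases "0 < x")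
        case True
        then have "\<bar>sparse_op lam S f x\<bar> powr p * w x \<le> (\<Sum>\<^sub>\<infinity>Q\<in>S. c Q * indicator Q x) powr p * w x"
          using elim w0 assms(2) by (intro mult_right_mono powr_mono2) auto
        then show ?thesis using True by (simp add: W_def mult.commute ennreal_leI)
      qed simp
    qed
    also have "\<dots> \<le> ennreal R" by (rule lim(2))
    finally show "Lp_w_pow p w (sparse_op lam S f)
        \<le> ennreal ((C * Ap_const lam p w powr (max 1 (1 / (p - 1)))) powr p) * Lp_w_pow p w f"
      unfolding R \<kappa>_def .
  qed
qed

end
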